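(* Let $\mathbb{H}^N$ be the Heisenberg group with homogeneous dimension $Q=2N+2$, let $\lambda\in\big(0,\big(\tfrac{Q-2}{2}\big)^2\big)$, $\gamma\in(0,1)$ and $\alpha\in[0,\infty)$. Assume that $$\int_{\mathbb{H}^N}\|\xi\|_H^{-\mu(\lambda)}u_0(\xi)\,d\xi<\infty,\qquad 0<\int_{\mathbb{H}^N}\|\xi\|_H^{-\mu(\lambda)}f(\xi)\,d\xi<\infty .$$ Then, for any $p>1$, the problem $$\partial_tu-\Delta_{H}u=\lambda \frac{\psi u}{\|\cdot\|_{H}^{2}}+\frac{1}{\Gamma(\gamma)}\int_0^t(t-\tau)^{\gamma-1}|u(\tau)|^{p}\,d\tau+t^\alpha f \ \text{ in } \mathbb{H}^N\times(0,T),\qquad u(\cdot,0)=u_0 \ \text{ in } \mathbb{H}^N,$$ does not admit a global-in-time weak solution.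
   Context: **Heisenberg group.** $\mathbb{H}^N$ is $\mathbb{R}^{2N+1}$ with points $\xi=(x,y,w)$, $x,y\in\mathbb{R}^N$, $w\in\mathbb{R}$, and group law $(x,y,w)\circ(x',y',w')=(x+x',y+y',w+w'+2\langle y,x'\rangle-2\langle x,y'\rangle)$. $Q=2N+2$. $d\xi$ is Lebesgue measure on $\mathbb{R}^{2N+1}$. Let $X_i=\partial_{x_i}+2y_i\partial_w$, $Y_i=\partial_{y_i}-2x_i\partial_w$ ($1\le i\le N$); $\nabla_H u=(X_1u,\dots,X_Nu,Y_1u,\dots,Y_Nu)$; $\Delta_H=\sum_{i=1}^N(X_i^2+Y_i^2)$; $\nabla_H\cdot$ denotes the corresponding horizontal divergence. The Korányi norm is $\|\xi\|_H=\big[\big(\sum_{i=1}^N(x_i^2+y_i^2)\big)^2+w^2\big]^{1/4}$, and $\psi=\big|\nabla_H\|\cdot\|_H\big|^2$. **Constant $\mu(\lambda)$.** For $\lambda\in(0,(\frac{Q-2}{2})^2)$, $\mu(\lambda)=\frac{Q-2}{2}-\sqrt{\big(\frac{Q-2}{2}\big)^2-\lambda}$. **Fractional integral.** For $\gamma\in(0,1)$, $I_{T^-}^\gamma\phi(t)=\frac{1}{\Gamma(\gamma)}\int_t^T(\tau-t)^{\gamma-1}\phi(\tau)\,d\tau$. **Weak solution.** Put $v(\xi,t)=\|\xi\|_H^{\mu(\lambda)}u(\xi,t)$, $v(0,\xi)=\|\xi\|_H^{\mu(\lambda)}u_0(\xi)$, and $L_H\phi=-\nabla_H\cdot\big(\|\cdot\|_H^{-2\mu(\lambda)}\nabla_H\phi\big)$.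 Let $v(0,\cdot)\in L^1_{\rm loc}(\mathbb{H}^N,\|\xi\|_H^{-2\mu(\lambda)}d\xi)$ and $f\in L^1_{\rm loc}(\mathbb{H}^N,\|\xi\|_H^{-\mu(\lambda)}d\xi)$. The function $v\in L^p_{\rm loc}((0,T),L^p_{\rm loc}(\mathbb{H}^N,\|\xi\|_H^{-(p+1)\mu(\lambda)}d\xi))\cap L^1_{\rm loc}((0,T),L^1_{\rm loc}(\mathbb{H}^N,\|\xi\|_H^{-2\mu(\lambda)}d\xi))$ (equivalently $u$) is a local-in-time weak solution of the problem on $(0,T)$ if $$-\int_0^T\!\!\int_{\mathbb{H}^N}v\big(\|\xi\|_H^{-2\mu(\lambda)}\partial_t\phi-L_H\phi\big)d\xi dt=\int_0^T\!\!\int_{\mathbb{H}^N}\|\xi\|_H^{-(p+1)\mu(\lambda)}|v|^pI^\gamma_{T^-}\phi\,d\xi dt+\int_{\mathbb{H}^N}\|\xi\|_H^{-2\mu(\lambda)}v(0,\xi)\phi(0,\xi)d\xi+\int_0^T\!\!\int_{\mathbb{H}^N}\|\xi\|_H^{-\mu(\lambda)}t^\alpha f\phi\,d\xi dt$$ for every non-negative test function $\phi\in C_c^1([0,T),C_c^2(\mathbb{H}^N))$. It is a global-in-time weak solution if $T=\infty$. The integral conditions on $u_0$ and $f$ are understood as saying that these integrals exist as finite real numbers. *)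

theory Defs
  imports "HOL-Analysis.Analysis"
begin

section \<open>Test functions of class \<open>C\<^sup>1\<close> in time with values in \<open>C\<^sup>2\<^sub>c\<close>\<close>

definition partial_deriv :: "'a::euclidean_space \<Rightarrow> ('a \<Rightarrow> real) \<Rightarrow> 'a \<Rightarrow> real" where
  "partial_deriv b g x = frechet_derivative g (at x) b"

definition C1_fun :: "('a::euclidean_space \<Rightarrow> real) \<Rightarrow> bool" where
  "C1_fun g \<longleftrightarrow> (\<forall>x. g differentiable (at x)) \<and> (\<forall>b\<in>Basis. continuous_on UNIV (partial_deriv b g))"

definition C2_fun :: "('a::euclidean_space \<Rightarrow> real) \<Rightarrow> bool" where
  "C2_fun g \<longleftrightarrow> C1_fun g \<and> (\<forall>b\<in>Basis. C1_fun (partial_deriv b g))"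

text \<open>Convergence in the \<open>C\<^sup>2\<close> norm.\<close>
definition C2_limit :: "('i \<Rightarrow> 'a::euclidean_space \<Rightarrow> real) \<Rightarrow> ('a \<Rightarrow> real) \<Rightarrow> 'i filter \<Rightarrow> bool" where
  "C2_limit g h F \<longleftrightarrow>
     uniform_limit UNIV g h F \<and>
     (\<forall>b\<in>Basis. uniform_limit UNIV (\<lambda>s. partial_deriv b (g s)) (partial_deriv b h) F) \<and>
     (\<forall>b\<in>Basis. \<forall>c\<in>Basis.
        uniform_limit UNIV (\<lambda>s. partial_deriv c (partial_deriv b (g s)))
          (partial_deriv c (partial_deriv b h)) F)"

text \<open>
  \<open>\<phi> \<in> C\<^sub>c\<^sup>1([0,T), C\<^sub>c\<^sup>2)\<close>. A continuous curve with compact support in the inductive limit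
  \<open>C\<^sub>c\<^sup>2 = \<Union>\<^sub>K C\<^sup>2\<^sub>K\<close> lives in a single \<open>C\<^sup>2\<^sub>K\<close>, whose topology is that of the \<open>C\<^sup>2\<close> norm; hence the
  common compact set \<open>K\<close>. The function \<open>\<phi>'\<close> is the time derivative (one-sided at \<open>0\<close>), taken
  with respect to the \<open>C\<^sup>2\<close> norm. Values of \<open>\<phi>\<close> at times outside \<open>[0,T)\<close> are irrelevant.
\<close>
definition test_function :: "ereal \<Rightarrow> (real \<Rightarrow> 'a::euclidean_space \<Rightarrow> real) \<Rightarrow> bool" where
  "test_function T \<phi> \<longleftrightarrow>
     (let I = {t. 0 \<le> t \<and> ereal t < T} in
        (\<exists>c K. ereal c < T \<and> compact K \<and>
           (\<forall>t\<in>I. \<forall>x. t > c \<or> x \<notin> K \<longrightarrow> \<phi> t x = 0)) \<and>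
        (\<forall>t\<in>I. C2_fun (\<phi> t)) \<and>
        (\<exists>\<phi>'. \<forall>t\<in>I. C2_fun (\<phi>' t) \<and>
           C2_limit (\<lambda>s x. (\<phi> s x - \<phi> t x) / (s - t)) (\<phi>' t) (at t within I) \<and>
           C2_limit \<phi>' (\<phi>' t) (at t within I)))"


section \<open>Weighted local Lebesgue spaces\<close>

text \<open>
  \<open>g \<in> L\<^sup>p\<^sub>l\<^sub>o\<^sub>c(S, w dx)\<close> for open \<open>S\<close>. For \<open>S = (0,T) \<times> \<real>\<^sup>d\<close> and \<open>w\<close> depending on the space
  variable only, this is \<open>L\<^sup>p\<^sub>l\<^sub>o\<^sub>c((0,T), L\<^sup>p\<^sub>l\<^sub>o\<^sub>c(\<real>\<^sup>d, w dx))\<close>.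
\<close>
definition locally_Lp ::
    "real \<Rightarrow> 'a::euclidean_space set \<Rightarrow> ('a \<Rightarrow> real) \<Rightarrow> ('a \<Rightarrow> real) \<Rightarrow> bool" where
  "locally_Lp p S w g \<longleftrightarrow>
     g \<in> borel_measurable (lebesgue_on S) \<and>
     (\<forall>K. compact K \<and> K \<subseteq> S \<longrightarrow> (\<lambda>x. \<bar>g x\<bar> powr p * w x) absolutely_integrable_on K)"


section \<open>The Heisenberg group\<close>

text \<open>Points \<open>(x, y, w)\<close> of \<open>\<real>\<^sup>2\<^sup>N\<^sup>+\<^sup>1\<close> with \<open>N = CARD('n)\<close>.\<close>
type_synonym 'n heis = "(real ^ 'n) \<times> (real ^ 'n) \<times> real"

definition hom_dim :: "'n::finite itself \<Rightarrow> nat" where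
  "hom_dim _ = 2 * CARD('n) + 2"

definition koranyi :: "'n::finite heis \<Rightarrow> real" where
  "koranyi = (\<lambda>(x, y, w). ((\<Sum>i\<in>UNIV. (x $ i)\<^sup>2 + (y $ i)\<^sup>2)\<^sup>2 + w\<^sup>2) powr (1 / 4))"

definition X_field :: "'n::finite \<Rightarrow> ('n heis \<Rightarrow> real) \<Rightarrow> 'n heis \<Rightarrow> real" where
  "X_field i g = (\<lambda>(x, y, w).
     partial_deriv (axis i 1, 0, 0) g (x, y, w) + 2 * y $ i * partial_deriv (0, 0, 1) g (x, y, w))"

definition Y_field :: "'n::finite \<Rightarrow> ('n heis \<Rightarrow> real) \<Rightarrow> 'n heis \<Rightarrow> real" where
  "Y_field i g = (\<lambda>(x, y, w).
     partial_deriv (0, axis i 1, 0) g (x, y, w) - 2 * x $ i * partial_deriv (0, 0, 1) g (x, y, w))"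

definition hgrad :: "('n::finite heis \<Rightarrow> real) \<Rightarrow> 'n heis \<Rightarrow> (real ^ 'n) \<times> (real ^ 'n)" where
  "hgrad g \<xi> = (\<chi> i. X_field i g \<xi>, \<chi> i. Y_field i g \<xi>)"

definition hdiv :: "('n::finite heis \<Rightarrow> (real ^ 'n) \<times> (real ^ 'n)) \<Rightarrow> 'n heis \<Rightarrow> real" where
  "hdiv V \<xi> = (\<Sum>i\<in>UNIV. X_field i (\<lambda>\<eta>. fst (V \<eta>) $ i) \<xi> + Y_field i (\<lambda>\<eta>. snd (V \<eta>) $ i) \<xi>)"

definition mu :: "'n::finite itself \<Rightarrow> real \<Rightarrow> real" where
  "mu N lam = (let h = (real (hom_dim N) - 2) / 2 in h - sqrt (h\<^sup>2 - lam))"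

text \<open>
  \<open>L\<^sub>H\<close>. The weight is singular at the origin, so the value there is meaningless; the origin is a
  null set.
\<close>
definition L_H :: "real \<Rightarrow> ('n::finite heis \<Rightarrow> real) \<Rightarrow> 'n heis \<Rightarrow> real" where
  "L_H lam g \<xi> = - hdiv (\<lambda>\<eta>. koranyi \<eta> powr (- 2 * mu TYPE('n) lam) *\<^sub>R hgrad g \<eta>) \<xi>"


section \<open>Weak solutions\<close>

definition frac_int :: "ereal \<Rightarrow> real \<Rightarrow> (real \<Rightarrow> real) \<Rightarrow> real \<Rightarrow> real" where
  "frac_int T \<gamma> g t =
     (LINT s:{s. t < s \<and> ereal s < T}|lebesgue. (s - t) powr (\<gamma> - 1) * g s) / Gamma \<gamma>"

text \<open>
  Weak solutions \<open>u\<close> on \<open>(0,T)\<close>, \<open>0 < T \<le> \<infinity>\<close>, with initial datum \<open>u\<^sub>0\<close> and source \<open>t\<^sup>\<alpha> f\<close>. The Hardy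
  potential does not occur explicitly: passing from \<open>u\<close> to \<open>v = \<parallel>\<cdot>\<parallel>\<^sup>\<mu> u\<close> absorbs it into \<open>L\<^sub>H\<close>.
  Since the integral of a non-integrable function is \<open>0\<close> by convention, the existence of the first
  two integrals in the identity is required explicitly; that of the other two follows from the
  local integrability of \<open>v\<^sub>0\<close> and \<open>f\<close>.
\<close>
definition weak_solution ::
    "ereal \<Rightarrow> real \<Rightarrow> real \<Rightarrow> real \<Rightarrow> real \<Rightarrow> ('n::finite heis \<Rightarrow> real) \<Rightarrow> ('n heis \<Rightarrow> real)
      \<Rightarrow> (real \<Rightarrow> 'n heis \<Rightarrow> real) \<Rightarrow> bool" where
  "weak_solution T lam \<gamma> \<alpha> p f u0 u \<longleftrightarrow>
    (let \<mu> = mu TYPE('n) lam;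
         S = {t. 0 < t \<and> ereal t < T} \<times> (UNIV :: 'n heis set);
         v = (\<lambda>t \<xi>. koranyi \<xi> powr \<mu> * u t \<xi>);
         v0 = (\<lambda>\<xi>. koranyi \<xi> powr \<mu> * u0 \<xi>);
         lin = (\<lambda>\<phi> (t, \<xi>). v t \<xi> *
                  (koranyi \<xi> powr (- 2 * \<mu>) * deriv (\<lambda>s. \<phi> s \<xi>) t - L_H lam (\<phi> t) \<xi>));
         nonlin = (\<lambda>\<phi> (t, \<xi>). koranyi \<xi> powr (- (p + 1) * \<mu>) * \<bar>v t \<xi>\<bar> powr p
                     * frac_int T \<gamma> (\<lambda>s. \<phi> s \<xi>) t)
     in 0 < T \<and>
        locally_Lp 1 UNIV (\<lambda>\<xi>. koranyi \<xi> powr (- 2 * \<mu>)) v0 \<and>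
        locally_Lp 1 UNIV (\<lambda>\<xi>. koranyi \<xi> powr (- \<mu>)) f \<and>
        locally_Lp p S (\<lambda>(t, \<xi>). koranyi \<xi> powr (- (p + 1) * \<mu>)) (\<lambda>(t, \<xi>). v t \<xi>) \<and>
        locally_Lp 1 S (\<lambda>(t, \<xi>). koranyi \<xi> powr (- 2 * \<mu>)) (\<lambda>(t, \<xi>). v t \<xi>) \<and>
        (\<forall>\<phi>. test_function T \<phi> \<and> (\<forall>t \<xi>. 0 \<le> t \<and> ereal t < T \<longrightarrow> 0 \<le> \<phi> t \<xi>) \<longrightarrow>
           set_integrable lebesgue S (lin \<phi>) \<and>
           set_integrable lebesgue S (nonlin \<phi>) \<and>
           - (LINT z:S|lebesgue. lin \<phi> z)
             = (LINT z:S|lebesgue. nonlin \<phi> z)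
               + (LINT \<xi>|lebesgue. koranyi \<xi> powr (- 2 * \<mu>) * v0 \<xi> * \<phi> 0 \<xi>)
               + (LINT z:S|lebesgue. case z of (t, \<xi>) \<Rightarrow>
                    koranyi \<xi> powr (- \<mu>) * t powr \<alpha> * f \<xi> * \<phi> t \<xi>)))"

definition global_weak_solution ::
    "real \<Rightarrow> real \<Rightarrow> real \<Rightarrow> real \<Rightarrow> ('n::finite heis \<Rightarrow> real) \<Rightarrow> ('n heis \<Rightarrow> real)
      \<Rightarrow> (real \<Rightarrow> 'n heis \<Rightarrow> real) \<Rightarrow> bool" where
  "global_weak_solution = weak_solution \<infinity>"

end

theory Submission
  imports Defs
begin

text \<open>
  Nonexistence follows from the test function method with a spatial cut-off that stays fixed while
  the time horizon \<open>T\<close> tends to infinity.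

  Test the equation with \<open>\<phi> (t, \<xi>) = \<eta> (t) \<Phi> (\<xi>)\<close>, where \<open>\<eta>\<close> is a power of the positive part of
  \<open>1 - t / T\<close> and \<open>\<Phi>\<close> is a power of a bump function of the Koranyi norm, supported in an annulus.
  As the annulus avoids the origin, all singular weights are bounded above and below on the
  support by positive constants. For radial functions \<open>L\<^sub>H\<close> has a closed form
  (\<open>L_H_radial\<close>), which shows that \<open>L\<^sub>H \<Phi>\<close> loses just two powers of the bump
  (\<open>L_H_annulus_bound\<close>).

  The nonlinear term contains the fractional integral of \<open>\<phi>\<close>, which is of order \<open>T powr \<gamma>\<close>
  (\<open>frac_int_decay_ge\<close>). By Young's inequality it absorbs the linear terms, leaving a remainder of
  order \<open>T powr (- \<gamma> / (p - 1))\<close> at each point of the support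
  (\<open>nonlinear_term_absorbs_linear_terms\<close>), hence of order \<open>T powr (1 - \<gamma> / (p - 1))\<close> after integration. The initial datum contributes a quantity that does
  not depend on \<open>T\<close>. The source term, on the other hand, is at least a constant times \<open>T\<close> as soon
  as the annulus is so wide that the weighted integral of \<open>f \<Phi>\<close> is positive
  (\<open>annulus_captures_mass\<close>, \<open>decay_time_integral\<close>). Hence
  \<open>c * T \<le> U + C * T powr (1 - \<gamma> / (p - 1))\<close> for all large \<open>T\<close>
  (\<open>global_weak_solution_mass_bound\<close>), which is absurd since \<open>c\<close> and \<open>\<gamma>\<close> are positive.
\<close>


section \<open>Closure properties of the classes \<open>C\<^sup>1\<close> and \<open>C\<^sup>2\<close>\<close>

lemma partial_deriv_eq:
  assumes "(g has_derivative D) (at x)"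
  shows "partial_deriv b g x = D b"
  using frechet_derivative_at[OF assms] by (simp add: partial_deriv_def)

lemma C1_funD:
  assumes "C1_fun g"
  shows "(g has_derivative (\<lambda>v. partial_deriv v g x)) (at x)"
  using assms frechet_derivative_works unfolding C1_fun_def partial_deriv_def by blast

text \<open>
  Derivatives are unique, so any derivative \<open>D\<close> that is found by the calculus rules may replace the
  chosen \<open>frechet_derivative\<close> in the definition of \<open>C1_fun\<close>. The closure properties of \<open>C\<^sup>1\<close> below
  are obtained in this way.
\<close>
lemma C1_funI:
  assumes "\<And>x. (g has_derivative D x) (at x)" "\<And>b. b \<in> Basis \<Longrightarrow> continuous_on UNIV (\<lambda>x. D x b)"
  shows "C1_fun g"
proof -
  have "partial_deriv b g = (\<lambda>x. D x b)" for b
    using partial_deriv_eq[OF assms(1)] by auto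
  then show ?thesis
    unfolding C1_fun_def using assms by (auto simp: differentiable_def)
qed

lemma C1_fun_continuous: "C1_fun g \<Longrightarrow> continuous_on UNIV g"
  by (intro continuous_at_imp_continuous_on ballI has_derivative_continuous[OF C1_funD])

lemma C1_fun_continuous_partial: "C1_fun g \<Longrightarrow> b \<in> Basis \<Longrightarrow> continuous_on UNIV (partial_deriv b g)"
  by (simp add: C1_fun_def)

lemma partial_deriv_add:
  "C1_fun f \<Longrightarrow> C1_fun g \<Longrightarrow>
    partial_deriv b (\<lambda>x. f x + g x) = (\<lambda>x. partial_deriv b f x + partial_deriv b g x)"
  by (intro ext partial_deriv_eq[OF has_derivative_add[OF C1_funD C1_funD]])

lemma partial_deriv_mult:
  "C1_fun f \<Longrightarrow> C1_fun g \<Longrightarrow>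
    partial_deriv b (\<lambda>x. f x * g x) = (\<lambda>x. f x * partial_deriv b g x + partial_deriv b f x * g x)"
  by (intro ext partial_deriv_eq[OF has_derivative_mult[OF C1_funD C1_funD]])

lemma has_derivative_real_compose:
  fixes h :: "real \<Rightarrow> real"
  assumes "(g has_derivative D) (at x)" and "(h has_real_derivative d) (at (g x))"
  shows "((\<lambda>x. h (g x)) has_derivative (\<lambda>v. d * D v)) (at x)"
  using has_derivative_compose[OF assms(1) assms(2)[unfolded has_field_derivative_def]]
  by simp

lemma partial_deriv_compose:
  fixes h h' :: "real \<Rightarrow> real"
  assumes "C1_fun g" and "\<And>s. (h has_real_derivative h' s) (at s)"
  shows "partial_deriv b (\<lambda>x. h (g x)) = (\<lambda>x. h' (g x) * partial_deriv b g x)"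
  by (intro ext partial_deriv_eq[OF has_derivative_real_compose[OF C1_funD[OF assms(1)] assms(2)]])

lemma C1_fun_linear:
  fixes g :: "'a::euclidean_space \<Rightarrow> real"
  assumes "bounded_linear g" shows "C1_fun g"
  by (rule C1_funI[OF bounded_linear_imp_has_derivative[OF assms]]) simp

lemma C1_fun_add:
  assumes "C1_fun f" "C1_fun g" shows "C1_fun (\<lambda>x. f x + g x)"
  by (rule C1_funI[OF has_derivative_add[OF assms[THEN C1_funD]]])
     (intro continuous_intros C1_fun_continuous_partial assms)

lemma C1_fun_mult:
  assumes "C1_fun f" "C1_fun g" shows "C1_fun (\<lambda>x. f x * g x)"
  by (rule C1_funI[OF has_derivative_mult[OF assms[THEN C1_funD]]])
     (intro continuous_intros C1_fun_continuous_partial C1_fun_continuous assms)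

lemma C1_fun_compose:
  fixes h h' :: "real \<Rightarrow> real"
  assumes "C1_fun g" and "\<And>s. (h has_real_derivative h' s) (at s)" and "continuous_on UNIV h'"
  shows "C1_fun (\<lambda>x. h (g x))"
  by (rule C1_funI[OF has_derivative_real_compose[OF C1_funD[OF assms(1)] assms(2)]])
     (intro continuous_intros C1_fun_continuous_partial C1_fun_continuous assms
       continuous_on_compose2[OF assms(3)] subset_UNIV)

lemma C2_fun_C1: "C2_fun g \<Longrightarrow> C1_fun g" by (simp add: C2_fun_def)

lemma C2_fun_C1_partial: "C2_fun g \<Longrightarrow> b \<in> Basis \<Longrightarrow> C1_fun (partial_deriv b g)"
  by (simp add: C2_fun_def)

lemma C1_fun_const: "C1_fun (\<lambda>_. c)"
  by (rule C1_funI[OF has_derivative_const]) simp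

lemma C2_fun_linear:
  fixes g :: "'a::euclidean_space \<Rightarrow> real"
  assumes "bounded_linear g" shows "C2_fun g"
proof -
  have "partial_deriv b g = (\<lambda>_. g b)" for b
    using partial_deriv_eq[OF bounded_linear_imp_has_derivative[OF assms]] by auto
  then show ?thesis by (simp add: C2_fun_def C1_fun_const C1_fun_linear[OF assms])
qed

lemma C2_fun_add: "C2_fun f \<Longrightarrow> C2_fun g \<Longrightarrow> C2_fun (\<lambda>x. f x + g x)"
  by (simp add: C2_fun_def partial_deriv_add C1_fun_add)

lemma C2_fun_mult: "C2_fun f \<Longrightarrow> C2_fun g \<Longrightarrow> C2_fun (\<lambda>x. f x * g x)"
  by (simp add: C2_fun_def partial_deriv_mult C1_fun_add C1_fun_mult)

lemma C2_fun_compose: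
  fixes h h' h'' :: "real \<Rightarrow> real"
  assumes "C2_fun g" and h: "\<And>s. (h has_real_derivative h' s) (at s)"
    and h': "\<And>s. (h' has_real_derivative h'' s) (at s)" and "continuous_on UNIV h''"
  shows "C2_fun (\<lambda>x. h (g x))"
proof -
  have "continuous_on UNIV h'"
    by (intro continuous_at_imp_continuous_on ballI DERIV_isCont[OF h'])
  with assms show ?thesis
    unfolding C2_fun_def
    by (simp add: partial_deriv_compose[OF _ h] C1_fun_compose[OF _ h]
        C1_fun_mult C1_fun_compose[OF _ h'])
qed


section \<open>Test functions of product form\<close>

text \<open>
  The complement of \<open>K\<close> is open, so the support of a function controls the supports of all its
  partial derivatives; in particular those of a compactly supported \<open>C\<^sup>2\<close> function are bounded.
\<close>
lemma partial_deriv_outside: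
  assumes "closed K" "\<And>x. x \<notin> K \<Longrightarrow> g x = 0" "x \<notin> K"
  shows "partial_deriv b g x = 0"
proof -
  have "(g has_derivative (\<lambda>v. 0)) (at x)"
    by (rule has_derivative_transform_within_open[of "\<lambda>_. 0" _ _ _ "- K"]) (use assms in auto)
  then show ?thesis by (rule partial_deriv_eq)
qed

lemma bounded_range_compact_support:
  fixes g :: "'a::euclidean_space \<Rightarrow> real"
  assumes "continuous_on UNIV g" "compact K" "\<And>x. x \<notin> K \<Longrightarrow> g x = 0"
  shows "bounded (range g)"
proof -
  have "bounded (g ` K)"
    using assms by (intro compact_imp_bounded compact_continuous_image continuous_on_subset[OF assms(1)]) auto
  moreover have "range g \<subseteq> insert 0 (g ` K)" using assms(3) by auto
  ultimately show ?thesis by (meson bounded_insert bounded_subset)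
qed

lemma uniform_limit_scaled:
  fixes g :: "'a \<Rightarrow> real"
  assumes "(a \<longlongrightarrow> a0) F" "bounded (range g)"
  shows "uniform_limit UNIV (\<lambda>s x. a s * g x) (\<lambda>x. a0 * g x) F"
proof (rule uniform_limitI)
  fix e :: real assume "e > 0"
  obtain B where B: "B > 0" "\<And>x. \<bar>g x\<bar> \<le> B"
    using assms(2) by (auto simp: bounded_pos)
  have "\<forall>\<^sub>F s in F. dist (a s) a0 < e / B"
    using assms(1) \<open>e > 0\<close> B by (intro tendstoD) auto
  then show "\<forall>\<^sub>F s in F. \<forall>x\<in>UNIV. dist (a s * g x) (a0 * g x) < e"
  proof eventually_elim
    case (elim s)
    show ?case
    proof
      fix x
      have "dist (a s * g x) (a0 * g x) = \<bar>a s - a0\<bar> * \<bar>g x\<bar>"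
        by (simp add: dist_real_def left_diff_distrib[symmetric] abs_mult)
      also have "\<dots> \<le> \<bar>a s - a0\<bar> * B" using B by (intro mult_left_mono) auto
      also have "\<dots> < e" using elim B by (simp add: dist_real_def pos_less_divide_eq)
      finally show "dist (a s * g x) (a0 * g x) < e" .
    qed
  qed
qed

lemma partial_deriv_cmult: "C1_fun g \<Longrightarrow> partial_deriv b (\<lambda>x. c * g x) = (\<lambda>x. c * partial_deriv b g x)"
  by (intro ext partial_deriv_eq[OF has_derivative_mult_right[OF C1_funD]])

text \<open>
  Since \<open>g\<close> and its derivatives of order at most two are bounded, \<open>a s * g\<close> depends on the scalar
  \<open>a s\<close> continuously in the \<open>C\<^sup>2\<close> norm.
\<close>
lemma C2_limit_scaled:
  fixes g :: "'a::euclidean_space \<Rightarrow> real"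
  assumes a: "(a \<longlongrightarrow> a0) F" and g: "C2_fun g" and K: "compact K" "\<And>x. x \<notin> K \<Longrightarrow> g x = 0"
  shows "C2_limit (\<lambda>s x. a s * g x) (\<lambda>x. a0 * g x) F"
proof -
  have K': "closed K" using K compact_imp_closed by blast
  have o1: "x \<notin> K \<Longrightarrow> partial_deriv b g x = 0" for b x
    by (rule partial_deriv_outside[OF K']) (rule K(2))
  have o2: "x \<notin> K \<Longrightarrow> partial_deriv c (partial_deriv b g) x = 0" for b c x
    by (rule partial_deriv_outside[OF K']) (rule o1)
  note c = C2_fun_C1[OF g] C2_fun_C1_partial[OF g]
  have "uniform_limit UNIV (\<lambda>s x. a s * g x) (\<lambda>x. a0 * g x) F"
    by (rule uniform_limit_scaled[OF a bounded_range_compact_support[OF _ K]])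
       (intro C1_fun_continuous c)
  moreover have "uniform_limit UNIV (\<lambda>s x. a s * partial_deriv b g x) (\<lambda>x. a0 * partial_deriv b g x) F"
    if "b \<in> Basis" for b
    by (rule uniform_limit_scaled[OF a bounded_range_compact_support[OF _ K(1) o1]])
       (intro C1_fun_continuous c that)
  moreover have "uniform_limit UNIV (\<lambda>s x. a s * partial_deriv c (partial_deriv b g) x)
      (\<lambda>x. a0 * partial_deriv c (partial_deriv b g) x) F"
    if "b \<in> Basis" "c \<in> Basis" for b c
    by (rule uniform_limit_scaled[OF a bounded_range_compact_support[OF _ K(1) o2]])
       (intro C1_fun_continuous_partial c that)
  ultimately show ?thesis
    unfolding C2_limit_def by (simp add: partial_deriv_cmult c)
qed

lemma C2_fun_cmult: "C2_fun g \<Longrightarrow> C2_fun (\<lambda>x. c * g x)"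
  by (simp add: C2_fun_def partial_deriv_cmult C1_fun_mult C1_fun_const)

text \<open>
  Only products of a function of time and a function of space are used to test the equation, and
  for these the curve lies on a single line of \<open>C\<^sup>2\<^sub>K\<close>: difference quotients converge because the
  scalar ones do.
\<close>
lemma test_function_product:
  fixes g :: "'a::euclidean_space \<Rightarrow> real"
  assumes a: "\<And>t. (a has_real_derivative a' t) (at t)" and a': "continuous_on UNIV a'"
    and T: "\<And>t. t > T \<Longrightarrow> a t = 0"
    and g: "C2_fun g" and K: "compact K" "\<And>x. x \<notin> K \<Longrightarrow> g x = 0"
  shows "test_function \<infinity> (\<lambda>t x. a t * g x)"
proof -
  have 1: "C2_limit (\<lambda>s x. (a s * g x - a t * g x) / (s - t)) (\<lambda>x. a' t * g x) (at t within {0..})" for t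
  proof -
    have "((\<lambda>s. (a s - a t) / (s - t)) \<longlongrightarrow> a' t) (at t within {0..})"
      using has_field_derivative_at_within[OF a] by (simp add: has_field_derivative_iff)
    from C2_limit_scaled[OF this g K] show ?thesis
      by (simp add: left_diff_distrib)
  qed
  have 2: "C2_limit (\<lambda>s x. a' s * g x) (\<lambda>x. a' t * g x) (at t within {0..})" for t
  proof -
    have "(a' \<longlongrightarrow> a' t) (at t within {0..})"
      using a' unfolding continuous_on_def by (auto intro: tendsto_within_subset)
    from C2_limit_scaled[OF this g K] show ?thesis .
  qed
  have "{t. 0 \<le> t \<and> ereal t < \<infinity>} = {0..}" by auto
  then show ?thesis
    unfolding test_function_def Let_def
  proof (simp only:, intro conjI exI[of _ T] exI[of _ K] exI[of _ "\<lambda>t x. a' t * g x"])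
    show "ereal T < \<infinity>" by simp
    show "compact K" by (rule K(1))
    show "\<forall>t\<in>{0..}. \<forall>x. T < t \<or> x \<notin> K \<longrightarrow> a t * g x = 0" using T K(2) by fastforce
    show "\<forall>t\<in>{0..}. C2_fun (\<lambda>x. a t * g x)" using C2_fun_cmult[OF g] by blast
    show "\<forall>t\<in>{0..}. C2_fun (\<lambda>x. a' t * g x)
      \<and> C2_limit (\<lambda>s x. (a s * g x - a t * g x) / (s - t)) (\<lambda>x. a' t * g x) (at t within {0..})
      \<and> C2_limit (\<lambda>t x. a' t * g x) (\<lambda>x. a' t * g x) (at t within {0..})"
      using C2_fun_cmult[OF g] 1 2 by blast
  qed
qed


section \<open>The horizontal operators on functions of the Koranyi norm\<close>

definition hor_sq :: "'n::finite heis \<Rightarrow> real" where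
  "hor_sq \<xi> = fst \<xi> \<bullet> fst \<xi> + fst (snd \<xi>) \<bullet> fst (snd \<xi>)"

text \<open>
  The fourth power of the Koranyi norm. Unlike the norm itself it is a polynomial, hence smooth
  also at the origin, and all weights of the problem are real powers of it.
\<close>
definition koranyi4 :: "'n::finite heis \<Rightarrow> real" where
  "koranyi4 \<xi> = hor_sq \<xi> * hor_sq \<xi> + snd (snd \<xi>) * snd (snd \<xi>)"

lemma koranyi4_nonneg: "0 \<le> koranyi4 \<xi>"
  by (simp add: koranyi4_def)

lemma hor_sq_nonneg: "0 \<le> hor_sq \<xi>"
  by (simp add: hor_sq_def)

lemma hor_sq_sum: "hor_sq \<xi> = (\<Sum>i\<in>UNIV. (fst \<xi> $ i)\<^sup>2 + (fst (snd \<xi>) $ i)\<^sup>2)"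
  by (simp add: hor_sq_def inner_vec_def sum.distrib power2_eq_square)

lemma koranyi_powr: "koranyi \<xi> powr e = koranyi4 \<xi> powr (e / 4)"
proof -
  have "koranyi \<xi> = koranyi4 \<xi> powr (1 / 4)"
    by (simp add: koranyi_def koranyi4_def hor_sq_sum case_prod_beta power2_eq_square)
  then show ?thesis by (simp add: powr_powr)
qed

lemma koranyi4_eq_0_iff: "koranyi4 \<xi> = 0 \<longleftrightarrow> \<xi> = 0"
  by (auto simp: koranyi4_def hor_sq_def prod_eq_iff add_nonneg_eq_0_iff)

lemma compact_koranyi4_le: "compact {\<xi>::'n::finite heis. koranyi4 \<xi> \<le> r}"
proof -
  have "closed {\<xi>::'n heis. koranyi4 \<xi> \<le> r}"
    unfolding koranyi4_def hor_sq_def by (intro closed_Collect_le continuous_intros)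
  moreover have "bounded {\<xi>::'n heis. koranyi4 \<xi> \<le> r}"
  proof (rule boundedI)
    fix \<xi> :: "'n heis" assume "\<xi> \<in> {\<xi>. koranyi4 \<xi> \<le> r}"
    then have r: "hor_sq \<xi> * hor_sq \<xi> + snd (snd \<xi>) * snd (snd \<xi>) \<le> r" by (simp add: koranyi4_def)
    have "(norm \<xi>)\<^sup>2 = hor_sq \<xi> + snd (snd \<xi>) * snd (snd \<xi>)"
      by (simp add: power2_norm_eq_inner hor_sq_def inner_prod_def)
    also have "\<dots> \<le> (hor_sq \<xi> * hor_sq \<xi> + 1) + snd (snd \<xi>) * snd (snd \<xi>)"
      using sum_squares_bound[of "hor_sq \<xi>" 1] hor_sq_nonneg[of \<xi>] by (simp add: power2_eq_square)
    also have "\<dots> \<le> r + 1" using r by simp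
    finally show "norm \<xi> \<le> sqrt (r + 1)" by (rule real_le_rsqrt)
  qed
  ultimately show ?thesis by (simp add: compact_eq_bounded_closed)
qed

lemma hor_sq_has_derivative:
  "(hor_sq has_derivative (\<lambda>v. 2 * (fst \<xi> \<bullet> fst v + fst (snd \<xi>) \<bullet> fst (snd v)))) (at \<xi>)"
  unfolding hor_sq_def
  by (auto intro!: derivative_eq_intros simp: inner_commute algebra_simps)

lemma partial_deriv_hor_sq:
  "partial_deriv v hor_sq = (\<lambda>\<xi>. 2 * (fst \<xi> \<bullet> fst v + fst (snd \<xi>) \<bullet> fst (snd v)))"
  by (intro ext partial_deriv_eq[OF hor_sq_has_derivative])

lemma C2_fun_hor_sq: "C2_fun hor_sq"
proof -
  have lin: "bounded_linear (\<lambda>\<xi>::'a heis. 2 * (fst \<xi> \<bullet> fst v + fst (snd \<xi>) \<bullet> fst (snd v)))" for v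
    by (intro linear_conv_bounded_linear[THEN iffD1] linearI)
       (auto simp: inner_add_left algebra_simps)
  have "C1_fun (hor_sq :: 'a heis \<Rightarrow> real)"
    by (rule C1_funI[OF hor_sq_has_derivative]) (intro continuous_intros)
  then show ?thesis
    unfolding C2_fun_def partial_deriv_hor_sq by (intro conjI ballI C1_fun_linear[OF lin])
qed

lemma bounded_linear_last: "bounded_linear (\<lambda>\<xi>::'n::finite heis. snd (snd \<xi>))"
  by (intro bounded_linear_compose[OF bounded_linear_snd] bounded_linear_snd)

lemma bounded_linear_x: "bounded_linear (\<lambda>\<xi>::'n::finite heis. fst \<xi> $ i)"
  by (intro bounded_linear_compose[OF bounded_linear_vec_nth] bounded_linear_fst)

lemma bounded_linear_y: "bounded_linear (\<lambda>\<xi>::'n::finite heis. fst (snd \<xi>) $ i)"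
  by (intro bounded_linear_compose[OF bounded_linear_vec_nth]
      bounded_linear_compose[OF bounded_linear_fst] bounded_linear_snd)

lemmas heis_linear = bounded_linear_x bounded_linear_y bounded_linear_last
lemmas heis_C1 = C2_fun_hor_sq[THEN C2_fun_C1] heis_linear[THEN C1_fun_linear]

lemma C2_fun_koranyi4: "C2_fun koranyi4"
  unfolding koranyi4_def[abs_def]
  by (intro C2_fun_add C2_fun_mult C2_fun_hor_sq C2_fun_linear bounded_linear_last)

lemma partial_deriv_linear: "bounded_linear g \<Longrightarrow> partial_deriv v g = (\<lambda>_. g v)"
  by (intro ext partial_deriv_eq[OF bounded_linear_imp_has_derivative])

lemma partial_deriv_koranyi4:
  "partial_deriv v koranyi4 \<xi> =
     4 * hor_sq \<xi> * (fst \<xi> \<bullet> fst v + fst (snd \<xi>) \<bullet> fst (snd v)) + 2 * snd (snd \<xi>) * snd (snd v)"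
  unfolding koranyi4_def[abs_def]
  by (simp add: partial_deriv_add partial_deriv_mult C1_fun_mult heis_C1
      partial_deriv_linear[OF bounded_linear_last] partial_deriv_hor_sq algebra_simps)

lemma X_field_koranyi4:
  "X_field i koranyi4 \<xi> = 4 * (hor_sq \<xi> * fst \<xi> $ i + snd (snd \<xi>) * fst (snd \<xi>) $ i)"
  by (cases \<xi>) (simp add: X_field_def partial_deriv_koranyi4 inner_axis algebra_simps)

lemma Y_field_koranyi4:
  "Y_field i koranyi4 \<xi> = 4 * (hor_sq \<xi> * fst (snd \<xi>) $ i - snd (snd \<xi>) * fst \<xi> $ i)"
  by (cases \<xi>) (simp add: Y_field_def partial_deriv_koranyi4 inner_axis algebra_simps)

text \<open>
  Squaring \<open>X_field\<close> and \<open>Y_field\<close> of \<open>koranyi4\<close> produces mixed terms in \<open>x\<^sub>i y\<^sub>i w\<close> with opposite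
  signs. Together with \<open>hlaplace_koranyi4\<close> this is what makes radial functions tractable: the
  squared horizontal gradient and the sub-Laplacian of \<open>koranyi4\<close> are both multiples of \<open>hor_sq\<close>
  with coefficients depending on \<open>koranyi4\<close> alone.
\<close>
lemma hgrad_koranyi4_sq:
  "(\<Sum>i\<in>UNIV. (X_field i koranyi4 \<xi>)\<^sup>2 + (Y_field i koranyi4 \<xi>)\<^sup>2) = 16 * hor_sq \<xi> * koranyi4 \<xi>"
proof -
  have "(X_field i koranyi4 \<xi>)\<^sup>2 + (Y_field i koranyi4 \<xi>)\<^sup>2
      = 16 * koranyi4 \<xi> * ((fst \<xi> $ i)\<^sup>2 + (fst (snd \<xi>) $ i)\<^sup>2)" for i
    by (simp add: X_field_koranyi4 Y_field_koranyi4 koranyi4_def power2_eq_square algebra_simps)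
  then show ?thesis
    by (simp add: sum_distrib_left[symmetric] hor_sq_sum)
qed

lemma C1_fun_diff: "C1_fun f \<Longrightarrow> C1_fun g \<Longrightarrow> C1_fun (\<lambda>x. f x - g x)"
  using C1_fun_add[of f "\<lambda>x. - 1 * g x"] C1_fun_mult[OF C1_fun_const, of g "-1"] by simp

lemma partial_deriv_diff:
  "C1_fun f \<Longrightarrow> C1_fun g \<Longrightarrow>
    partial_deriv b (\<lambda>x. f x - g x) = (\<lambda>x. partial_deriv b f x - partial_deriv b g x)"
  by (intro ext partial_deriv_eq[OF has_derivative_diff[OF C1_funD C1_funD]])

lemma C1_fun_X_field_koranyi4: "C1_fun (X_field i koranyi4)"
  unfolding X_field_koranyi4[abs_def]
  by (intro C1_fun_mult C1_fun_add C1_fun_const heis_C1)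

lemma C1_fun_Y_field_koranyi4: "C1_fun (Y_field i koranyi4)"
  unfolding Y_field_koranyi4[abs_def]
  by (intro C1_fun_mult C1_fun_diff C1_fun_const heis_C1)

lemma X_field_X_field_koranyi4:
  "X_field i (X_field i koranyi4) \<xi> = 4 * hor_sq \<xi> + 8 * ((fst \<xi> $ i)\<^sup>2 + (fst (snd \<xi>) $ i)\<^sup>2)"
proof -
  have "partial_deriv v (X_field i koranyi4) \<xi> =
    4 * (2 * (fst \<xi> \<bullet> fst v + fst (snd \<xi>) \<bullet> fst (snd v)) * fst \<xi> $ i + hor_sq \<xi> * fst v $ i
      + snd (snd v) * fst (snd \<xi>) $ i + snd (snd \<xi>) * fst (snd v) $ i)" for v
    unfolding X_field_koranyi4[abs_def]
    by (simp add: partial_deriv_cmult partial_deriv_add partial_deriv_mult C1_fun_mult C1_fun_add heis_C1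
        heis_linear[THEN partial_deriv_linear] partial_deriv_hor_sq
        del: distrib_left_numeral right_diff_distrib_numeral)
  then show ?thesis
    unfolding X_field_def[of i "X_field i koranyi4"]
    by (cases \<xi>) (simp add: inner_axis power2_eq_square algebra_simps)
qed

lemma Y_field_Y_field_koranyi4:
  "Y_field i (Y_field i koranyi4) \<xi> = 4 * hor_sq \<xi> + 8 * ((fst \<xi> $ i)\<^sup>2 + (fst (snd \<xi>) $ i)\<^sup>2)"
proof -
  have *: "partial_deriv v (Y_field i koranyi4) \<xi> =
    4 * (2 * (fst \<xi> \<bullet> fst v + fst (snd \<xi>) \<bullet> fst (snd v)) * fst (snd \<xi>) $ i + hor_sq \<xi> * fst (snd v) $ i
      - (snd (snd v) * fst \<xi> $ i + snd (snd \<xi>) * fst v $ i))" for v and \<xi> :: "'a heis"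
    unfolding Y_field_koranyi4[abs_def]
    by (simp add: partial_deriv_cmult partial_deriv_diff partial_deriv_mult C1_fun_mult C1_fun_diff heis_C1
        heis_linear[THEN partial_deriv_linear] partial_deriv_hor_sq
        del: distrib_left_numeral right_diff_distrib_numeral)
  show ?thesis
    by (cases \<xi>) (simp add: Y_field_def[of i "Y_field i koranyi4"] * inner_axis power2_eq_square algebra_simps)
qed

lemma hlaplace_koranyi4:
  "(\<Sum>i\<in>UNIV. X_field i (X_field i koranyi4) \<xi> + Y_field i (Y_field i koranyi4) (\<xi> :: 'n::finite heis))
    = (8 * real CARD('n) + 16) * hor_sq \<xi>"
proof -
  have "(\<Sum>i\<in>(UNIV::'n set). X_field i (X_field i koranyi4) \<xi> + Y_field i (Y_field i koranyi4) \<xi>)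
     = (\<Sum>i\<in>(UNIV::'n set). 8 * hor_sq \<xi> + 16 * ((fst \<xi> $ i)\<^sup>2 + (fst (snd \<xi>) $ i)\<^sup>2))"
    by (rule sum.cong) (auto simp: X_field_X_field_koranyi4 Y_field_Y_field_koranyi4)
  also have "\<dots> = 8 * real CARD('n) * hor_sq \<xi> + 16 * hor_sq \<xi>"
    by (simp add: sum.distrib sum_distrib_left[symmetric] hor_sq_sum[of \<xi>])
  finally show ?thesis by (simp add: algebra_simps)
qed

lemma partial_deriv_compose_mult:
  assumes "(G has_real_derivative g') (at (s x))" "C1_fun s" "C1_fun A"
  shows "partial_deriv v (\<lambda>x. G (s x) * A x) x = G (s x) * partial_deriv v A x + g' * partial_deriv v s x * A x"
  by (rule partial_deriv_eq[OF has_derivative_mult[OF has_derivative_real_compose[OF C1_funD[OF assms(2)] assms(1)]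
        C1_funD[OF assms(3)]]])

lemma X_field_compose_mult:
  assumes "(G has_real_derivative g') (at (s \<xi>))" "C1_fun s" "C1_fun A"
  shows "X_field i (\<lambda>\<eta>. G (s \<eta>) * A \<eta>) \<xi> = G (s \<xi>) * X_field i A \<xi> + g' * X_field i s \<xi> * A \<xi>"
  using partial_deriv_compose_mult[OF assms]
  by (cases \<xi>) (simp add: X_field_def algebra_simps)

lemma Y_field_compose_mult:
  assumes "(G has_real_derivative g') (at (s \<xi>))" "C1_fun s" "C1_fun A"
  shows "Y_field i (\<lambda>\<eta>. G (s \<eta>) * A \<eta>) \<xi> = G (s \<xi>) * Y_field i A \<xi> + g' * Y_field i s \<xi> * A \<xi>"
  using partial_deriv_compose_mult[OF assms]
  by (cases \<xi>) (simp add: Y_field_def algebra_simps)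

text \<open>
  For \<open>s = koranyi4\<close> the weighted horizontal gradient of \<open>h \<circ> s\<close> is \<open>G (s) \<nabla>\<^sub>H s\<close> with
  \<open>G (s) = s powr (- \<mu> / 2) * h' s\<close>, so the product rule turns its divergence into
  \<open>G' (s) \<bar>\<nabla>\<^sub>H s\<bar>\<^sup>2 + G (s) \<Delta>\<^sub>H s\<close>, and both factors are known. The formula
  covers the origin too when \<open>h'\<close> vanishes near \<open>0\<close>, since \<open>G\<close> then has derivative \<open>0\<close> there.
\<close>
lemma L_H_radial:
  fixes \<xi> :: "'n::finite heis"
  assumes h: "\<And>s. (h has_real_derivative h' s) (at s)"
    and G: "((\<lambda>s. s powr (- mu TYPE('n) lam / 2) * h' s) has_real_derivative g') (at (koranyi4 \<xi>))"
  shows "L_H lam (\<lambda>\<eta>. h (koranyi4 \<eta>)) \<xi> = - hor_sq \<xi> * (16 * koranyi4 \<xi> * g'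
     + (8 * real CARD('n) + 16) * (koranyi4 \<xi> powr (- mu TYPE('n) lam / 2) * h' (koranyi4 \<xi>)))"
proof -
  define G where "G = (\<lambda>s. s powr (- mu TYPE('n) lam / 2) * h' s)"
  have C1: "C1_fun (koranyi4 :: 'n heis \<Rightarrow> real)" by (intro C2_fun_C1 C2_fun_koranyi4)
  have X: "X_field i (\<lambda>\<eta>. h (koranyi4 \<eta>)) \<eta> = h' (koranyi4 \<eta>) * X_field i koranyi4 \<eta>" for i and \<eta> :: "'n heis"
    by (cases \<eta>) (simp add: X_field_def partial_deriv_compose[OF C1 h] algebra_simps)
  have Y: "Y_field i (\<lambda>\<eta>. h (koranyi4 \<eta>)) \<eta> = h' (koranyi4 \<eta>) * Y_field i koranyi4 \<eta>" for i and \<eta> :: "'n heis"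
    by (cases \<eta>) (simp add: Y_field_def partial_deriv_compose[OF C1 h] algebra_simps)
  have "L_H lam (\<lambda>\<eta>. h (koranyi4 \<eta>)) \<xi> =
     - (\<Sum>i\<in>UNIV. X_field i (\<lambda>\<eta>. G (koranyi4 \<eta>) * X_field i koranyi4 \<eta>) \<xi>
         + Y_field i (\<lambda>\<eta>. G (koranyi4 \<eta>) * Y_field i koranyi4 \<eta>) \<xi>)"
    unfolding L_H_def hdiv_def by (simp add: hgrad_def X Y koranyi_powr G_def mult.assoc)
  also have "(\<Sum>i\<in>UNIV. X_field i (\<lambda>\<eta>. G (koranyi4 \<eta>) * X_field i koranyi4 \<eta>) \<xi>
         + Y_field i (\<lambda>\<eta>. G (koranyi4 \<eta>) * Y_field i koranyi4 \<eta>) \<xi>)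
     = (\<Sum>i\<in>UNIV. g' * ((X_field i koranyi4 \<xi>)\<^sup>2 + (Y_field i koranyi4 \<xi>)\<^sup>2)
         + G (koranyi4 \<xi>) * (X_field i (X_field i koranyi4) \<xi> + Y_field i (Y_field i koranyi4) \<xi>))"
    by (simp add: X_field_compose_mult[OF G[folded G_def] C1 C1_fun_X_field_koranyi4]
      Y_field_compose_mult[OF G[folded G_def] C1 C1_fun_Y_field_koranyi4] power2_eq_square algebra_simps)
  also have "\<dots> = g' * (16 * hor_sq \<xi> * koranyi4 \<xi>) + G (koranyi4 \<xi>) * ((8 * real CARD('n) + 16) * hor_sq \<xi>)"
    unfolding hgrad_koranyi4_sq[of \<xi>, symmetric] hlaplace_koranyi4[of \<xi>, symmetric]
    by (simp add: sum.distrib sum_distrib_left distrib_left)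
  finally show ?thesis by (simp add: G_def algebra_simps)
qed


section \<open>Products of Lebesgue integrable functions\<close>

lemma AE_times_eq:
  fixes a a' :: "'a::euclidean_space \<Rightarrow> real" and b b' :: "'b::euclidean_space \<Rightarrow> real"
  assumes "AE x in lborel. a x = a' x" "AE y in lborel. b y = b' y"
  shows "AE z in lborel. a (fst z) * b (snd z) = a' (fst z) * b' (snd z)"
proof -
  obtain M where M: "{x \<in> space lborel. a x \<noteq> a' x} \<subseteq> M" "M \<in> null_sets lborel"
    using assms(1) unfolding eventually_ae_filter by blast
  obtain N where N: "{y \<in> space lborel. b y \<noteq> b' y} \<subseteq> N" "N \<in> null_sets lborel"
    using assms(2) unfolding eventually_ae_filter by blast
  have 1: "M \<times> UNIV \<in> null_sets (lborel \<Otimes>\<^sub>M lborel)"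
    by (rule lborel.times_in_null_sets1[OF M(2)]) simp
  have 2: "UNIV \<times> N \<in> null_sets (lborel \<Otimes>\<^sub>M lborel)"
    by (rule lborel.times_in_null_sets2[OF _ N(2)]) simp
  have "M \<times> UNIV \<union> UNIV \<times> N \<in> null_sets (lborel :: ('a \<times> 'b) measure)"
    using null_sets.Un[OF 1 2] by (simp only: lborel_prod)
  then show ?thesis
  proof (rule AE_I')
    show "{z \<in> space lborel. \<not> a (fst z) * b (snd z) = a' (fst z) * b' (snd z)} \<subseteq> M \<times> UNIV \<union> UNIV \<times> N"
    proof
      fix z assume "z \<in> {z \<in> space lborel. \<not> a (fst z) * b (snd z) = a' (fst z) * b' (snd z)}"
      then have "a (fst z) \<noteq> a' (fst z) \<or> b (snd z) \<noteq> b' (snd z)" by auto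
      then show "z \<in> M \<times> UNIV \<union> UNIV \<times> N"
        using M(1) N(1) by (cases z) auto
    qed
  qed
qed

lemma borel_measurable_lebesgue_AE:
  fixes f g :: "'a::euclidean_space \<Rightarrow> real"
  assumes g: "g \<in> borel_measurable borel" and eq: "AE x in lborel. f x = g x"
  shows "f \<in> borel_measurable lebesgue"
proof (rule measurableI)
  fix A :: "real set" assume "A \<in> sets borel"
  then have 1: "g -` A \<in> sets lebesgue"
    using measurable_sets[OF g] by simp
  have 2: "AE x in lebesgue. x \<in> g -` A \<longleftrightarrow> x \<in> f -` A"
    using AE_completion[OF eq] by eventually_elim simp
  show "f -` A \<inter> space lebesgue \<in> sets lebesgue"
    using completion.in_sets_AE[OF 2 1] by simp
qed simp

text \<open>
  Lebesgue measure on a product is the completion of the product measure and not itself a product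
  measure, so Fubini's theorem applies to Borel representatives of the two factors; passing back
  changes the product function only on a null set.
\<close>
lemma lebesgue_integrable_times:
  fixes a :: "'a::euclidean_space \<Rightarrow> real" and b :: "'b::euclidean_space \<Rightarrow> real"
  assumes "integrable lebesgue a" "integrable lebesgue b"
  shows "integrable lebesgue (\<lambda>z. a (fst z) * b (snd z))"
    and "(LINT z|lebesgue. a (fst z) * b (snd z)) = (LINT x|lebesgue. a x) * (LINT y|lebesgue. b y)"
proof -
  obtain a' where a': "a' \<in> borel_measurable lborel" "AE x in lborel. a x = a' x"
    using completion_ex_borel_measurable_real[OF borel_measurable_integrable[OF assms(1)]] by auto
  obtain b' where b': "b' \<in> borel_measurable lborel" "AE x in lborel. b x = b' x"
    using completion_ex_borel_measurable_real[OF borel_measurable_integrable[OF assms(2)]] by auto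
  note [measurable] = a'(1) b'(1)
  have ia: "integrable lborel a'" and ea: "integral\<^sup>L lebesgue a = integral\<^sup>L lborel a'"
    using integrable_cong_AE[OF borel_measurable_integrable[OF assms(1)], of a'] assms(1)
      integral_cong_AE[OF borel_measurable_integrable[OF assms(1)], of a']
      AE_completion[OF a'(2)] a'(1)
    by (simp_all add: integrable_completion integral_completion measurable_completion)
  have ib: "integrable lborel b'" and eb: "integral\<^sup>L lebesgue b = integral\<^sup>L lborel b'"
    using integrable_cong_AE[OF borel_measurable_integrable[OF assms(2)], of b'] assms(2)
      integral_cong_AE[OF borel_measurable_integrable[OF assms(2)], of b']
      AE_completion[OF b'(2)] b'(1)
    by (simp_all add: integrable_completion integral_completion measurable_completion)
  let ?g = "\<lambda>z. a' (fst z) * b' (snd z)"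
  have int: "integrable (lborel \<Otimes>\<^sub>M lborel) ?g"
    by (rule lborel_pair.Fubini_integrable) (auto simp: abs_mult ia ib)
  have val: "integral\<^sup>L (lborel \<Otimes>\<^sub>M lborel) ?g = integral\<^sup>L lborel a' * integral\<^sup>L lborel b'"
    using lborel_pair.integral_fst'[OF int] by simp
  have g: "?g \<in> borel_measurable (lborel :: ('a \<times> 'b) measure)"
    using borel_measurable_integrable[OF int] by (simp add: lborel_prod)
  have ae: "AE z in lborel. a (fst z) * b (snd z) = ?g z"
    by (rule AE_times_eq[OF a'(2) b'(2)])
  have f: "(\<lambda>z. a (fst z) * b (snd z)) \<in> borel_measurable lebesgue"
    by (rule borel_measurable_lebesgue_AE[OF _ ae]) (use g in simp)
  show "integrable lebesgue (\<lambda>z. a (fst z) * b (snd z))"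
    using integrable_cong_AE[OF f measurable_completion[OF g] AE_completion[OF ae]]
      int integrable_completion[OF g] by (simp add: lborel_prod)
  show "(LINT z|lebesgue. a (fst z) * b (snd z)) = (LINT x|lebesgue. a x) * (LINT y|lebesgue. b y)"
    using integral_cong_AE[OF f measurable_completion[OF g] AE_completion[OF ae]]
      val integral_completion[OF g] by (simp add: lborel_prod ea eb)
qed


section \<open>The cut-off in time\<close>

text \<open>
  Powers of positive parts serve as cut-offs in both variables: differentiating lowers the exponent
  and keeps the shape, so derivatives are controlled by lower powers of the same function.
\<close>
lemma DERIV_pospart_power:
  assumes "(r has_real_derivative r') (at x)"
  shows "((\<lambda>x. max 0 (r x) ^ (k + 2)) has_real_derivative real (k + 2) * max 0 (r x) ^ (k + 1) * r') (at x)"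
proof -
  have "((\<lambda>y. max 0 y ^ (k + 2)) has_real_derivative (k + 2) * max 0 y ^ (k + 1)) (at y)" for y :: real
  proof -
    consider "y > 0" | "y < 0" | "y = 0" by linarith
    then show ?thesis
    proof cases
      case 1
      have "((\<lambda>y. y ^ (k + 2)) has_real_derivative real (k + 2) * y ^ (k + 2 - Suc 0)) (at y)"
        by (rule DERIV_pow)
      then have "((\<lambda>y. max 0 y ^ (k + 2)) has_real_derivative real (k + 2) * y ^ (k + 2 - Suc 0)) (at y)"
        by (rule has_field_derivative_transform_within_open[where S="{0<..}"])
           (use 1 in \<open>auto simp: max_absorb2\<close>)
      then show ?thesis using 1 by (simp add: max_absorb2)
    next
      case 2
      have "((\<lambda>y. max 0 y ^ (k + 2)) has_real_derivative 0) (at y)"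
        by (rule has_field_derivative_transform_within_open[where S="{..<0}" and f="\<lambda>y. 0"])
           (use 2 in \<open>auto simp: max_absorb1\<close>)
      then show ?thesis using 2 by (simp add: max_absorb1)
    next
      case 3
      have "((\<lambda>y::real. max 0 y ^ (k + 1)) \<longlongrightarrow> max 0 0 ^ (k + 1)) (at 0)"
        by (intro tendsto_power tendsto_max tendsto_const tendsto_ident_at)
      then have "((\<lambda>y::real. max 0 y ^ (k + 1)) \<longlongrightarrow> 0) (at 0)" by simp
      moreover have "\<forall>\<^sub>F y::real in at 0. max 0 y ^ (k + 1) = max 0 y ^ (k + 2) / y"
      proof -
        have "max 0 y ^ (k + 1) = max 0 y ^ (k + 2) / y" if "y \<noteq> 0" for y :: real
          using that by (cases "y > 0") (auto simp: max_absorb1 max_absorb2)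
        then show ?thesis by (simp add: eventually_at_filter)
      qed
      ultimately have "((\<lambda>y::real. max 0 y ^ (k + 2) / y) \<longlongrightarrow> 0) (at 0)"
        by (rule Lim_transform_eventually)
      then show ?thesis using 3 by (simp add: has_field_derivative_iff)
    qed
  qed
  from DERIV_chain2[OF this assms] show ?thesis .
qed

definition decay :: "nat \<Rightarrow> real \<Rightarrow> real \<Rightarrow> real" where
  "decay k T t = max 0 (1 - t / T) ^ (k + 3)"

definition decay_deriv :: "nat \<Rightarrow> real \<Rightarrow> real \<Rightarrow> real" where
  "decay_deriv k T t = - (real (k + 3) / T * max 0 (1 - t / T) ^ (k + 2))"

lemma DERIV_decay:
  assumes "0 < T" shows "(decay k T has_real_derivative decay_deriv k T t) (at t)"
proof -
  have "((\<lambda>t. max 0 (1 - t / T) ^ (k + 1 + 2)) has_real_derivative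
      real (k + 1 + 2) * max 0 (1 - t / T) ^ (k + 1 + 1) * (- 1 / T)) (at t)"
    by (rule DERIV_pospart_power) (use assms in \<open>auto intro!: derivative_eq_intros\<close>)
  then show ?thesis
    unfolding decay_def[abs_def] decay_deriv_def by (simp add: numeral_eq_Suc)
qed

text \<open>
  For \<open>t \<ge> 1\<close> the factor \<open>t powr \<alpha>\<close> is at least \<open>1\<close>, so linear growth in \<open>T\<close> is available for every
  \<open>\<alpha> \<ge> 0\<close>: it suffices to integrate over \<open>[1, T / 2]\<close>, where the cut-off is at least
  \<open>(1 / 2) ^ (k + 3)\<close>. The length of this interval is at least \<open>T / 4\<close> for \<open>T \<ge> 4\<close>.
\<close>
lemma decay_time_integral:
  assumes T: "4 \<le> T" and \<alpha>: "0 \<le> \<alpha>"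
  shows "integrable lebesgue (\<lambda>t. indicator {0<..} t * (t powr \<alpha> * decay k T t))" (is "integrable _ ?a")
    and "T / 4 * (1 / 2) ^ (k + 3) \<le> (LINT t|lebesgue. indicator {0<..} t * (t powr \<alpha> * decay k T t))"
proof -
  have dec: "0 \<le> decay k T t" "t \<ge> 0 \<Longrightarrow> decay k T t \<le> 1" "t > T \<Longrightarrow> decay k T t = 0" for t
    using T by (auto simp: decay_def max_def intro!: power_le_one)
  have iT: "integrable lebesgue (\<lambda>t. indicator {0..T} t * T powr \<alpha>)"
    using T by (intro integrable_mult_left integrable_real_indicator) auto
  have meas: "?a \<in> borel_measurable lebesgue"
    unfolding decay_def by (rule measurable_completion) measurable
  show int: "integrable lebesgue ?a"
  proof (rule Bochner_Integration.integrable_bound[OF iT meas], intro AE_I2)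
    fix t
    show "norm (?a t) \<le> norm (indicator {0..T} t * T powr \<alpha>)"
    proof (cases "t \<in> {0<..T}")
      case True
      then have "t powr \<alpha> * decay k T t \<le> T powr \<alpha> * 1"
        using \<alpha> dec by (intro mult_mono powr_mono2) auto
      then show ?thesis using True dec(1)[of t] by simp
    next
      case False
      then have "?a t = 0" using dec(3)[of t] by (cases "0 < t") auto
      then show ?thesis by (simp only: norm_zero norm_ge_zero)
    qed
  qed
  have ilo: "integrable lebesgue (\<lambda>t. indicator {1..T / 2} t * (1 / 2 :: real) ^ (k + 3))"
    using T by (intro integrable_mult_left integrable_real_indicator) auto
  have "T / 4 * (1 / 2) ^ (k + 3) \<le> (T / 2 - 1) * (1 / 2) ^ (k + 3)"
    using T by (intro mult_right_mono) auto
  also have "\<dots> = (LINT t|lebesgue. indicator {1..T / 2} t * (1 / 2) ^ (k + 3))"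
    using T by simp
  also have "\<dots> \<le> (LINT t|lebesgue. ?a t)"
  proof (rule integral_mono[OF ilo int])
    fix t
    show "indicator {1..T / 2} t * (1 / 2) ^ (k + 3) \<le> ?a t"
    proof (cases "t \<in> {1..T / 2}")
      case True
      have "t / T \<le> 1 / 2" using True T by (simp add: pos_divide_le_eq)
      then have "1 / 2 \<le> max 0 (1 - t / T)" by linarith
      then have "(1 / 2) ^ (k + 3) \<le> decay k T t"
        unfolding decay_def by (rule power_mono) simp
      moreover have "1 \<le> t powr \<alpha>" using True \<alpha> by (auto intro: ge_one_powr_ge_zero)
      ultimately have "1 * (1 / 2) ^ (k + 3) \<le> t powr \<alpha> * decay k T t"
        by (intro mult_mono) auto
      then show ?thesis using True by simp
    next
      case False
      then show ?thesis using dec(1)[of t] by simp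
    qed
  qed
  finally show "T / 4 * (1 / 2) ^ (k + 3) \<le> (LINT t|lebesgue. ?a t)" .
qed


section \<open>Fractional integral of the time cut-off\<close>

lemma has_integral_shifted_powr:
  fixes \<gamma> :: real
  assumes "0 < \<gamma>" "t \<le> T"
  shows "((\<lambda>s. (s - t) powr (\<gamma> - 1)) has_integral (T - t) powr \<gamma> / \<gamma>) {t..T}"
proof -
  have "((\<lambda>s. (s - t) powr (\<gamma> - 1)) has_integral (T - t) powr \<gamma> / \<gamma> - (t - t) powr \<gamma> / \<gamma>) {t..T}"
  proof (rule fundamental_theorem_of_calculus_interior[OF assms(2)])
    show "continuous_on {t..T} (\<lambda>s. (s - t) powr \<gamma> / \<gamma>)"
      using assms by (intro continuous_on_divide continuous_on_powr' continuous_intros) auto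
    show "((\<lambda>s. (s - t) powr \<gamma> / \<gamma>) has_vector_derivative (s - t) powr (\<gamma> - 1)) (at s)"
      if "s \<in> {t<..<T}" for s
      using assms that unfolding has_real_derivative_iff_has_vector_derivative[symmetric]
      by (auto intro!: derivative_eq_intros)
  qed
  then show ?thesis by simp
qed

lemma frac_int_nonneg:
  assumes "0 < \<gamma>" "\<And>s. 0 \<le> a s" shows "0 \<le> frac_int T \<gamma> a t"
  unfolding frac_int_def set_lebesgue_integral_def using assms
  by (intro divide_nonneg_pos integral_nonneg_AE AE_I2) (auto simp: indicator_def Gamma_real_pos)

text \<open>
  On \<open>(t, T)\<close> the kernel is at least \<open>(T - t) powr (\<gamma> - 1)\<close>, because its exponent is negative. This
  lower bound has the same order in \<open>T\<close> and in \<open>1 - t / T\<close> as the exact value, which is a Beta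
  integral, and leaves only a polynomial to integrate.
\<close>
lemma frac_int_decay_ge:
  fixes \<gamma> :: real
  assumes \<gamma>: "0 < \<gamma>" "\<gamma> < 1" and T: "0 < T" and t: "t \<le> T" and m: "0 < m"
  shows "frac_int \<infinity> \<gamma> (\<lambda>s. max 0 (1 - s / T) ^ m) t
    \<ge> T powr \<gamma> * (1 - t / T) powr (m + \<gamma>) / ((m + 1) * Gamma \<gamma>)"
proof -
  let ?a = "\<lambda>s. max 0 (1 - s / T) ^ m"
  let ?f = "\<lambda>s. (s - t) powr (\<gamma> - 1) * ?a s"
  let ?g = "\<lambda>s. (T - t) powr (\<gamma> - 1) * ?a s"
  show ?thesis
  proof (cases "t = T")
    case True
    have "0 \<le> frac_int \<infinity> \<gamma> ?a t" using \<gamma>(1) by (rule frac_int_nonneg) simp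
    then show ?thesis using True T \<gamma> by simp
  next
    case False
    with t have "t < T" by simp
    \<comment> \<open>Integrability has to be secured, since the integral would otherwise be \<open>0\<close> by convention.\<close>
    have "(\<lambda>s. ?a s * (s - t) powr (\<gamma> - 1)) absolutely_integrable_on {t..T}"
    proof (rule absolutely_integrable_bounded_measurable_product_real)
      show "?a \<in> borel_measurable (lebesgue_on {t..T})"
        by (intro continuous_imp_measurable_on_sets_lebesgue continuous_intros) (use T in auto)
      show "bounded (?a ` {t..T})"
        by (intro compact_imp_bounded compact_continuous_image continuous_intros) (use T in auto)
      show "(\<lambda>s. (s - t) powr (\<gamma> - 1)) absolutely_integrable_on {t..T}"
        by (intro nonnegative_absolutely_integrable_1
            has_integral_integrable[OF has_integral_shifted_powr[OF \<gamma>(1) t]]) auto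
    qed simp
    then have f: "?f absolutely_integrable_on {t..T}" by (simp add: mult.commute)
    have g: "?g absolutely_integrable_on {t..T}"
      by (intro absolutely_integrable_continuous_real continuous_intros) (use T in auto)
    have gval: "(LINT s:{t..T}|lebesgue. ?g s) = T powr \<gamma> * (1 - t / T) powr (m + \<gamma>) / (m + 1)"
    proof -
      have "((\<lambda>s. (1 - s / T) ^ m) has_integral
          - (T / (m + 1)) * (1 - T / T) ^ (m + 1) - (- (T / (m + 1)) * (1 - t / T) ^ (m + 1))) {t..T}"
      proof (rule fundamental_theorem_of_calculus[OF t])
        fix s
        have "((\<lambda>s. - (T / (m + 1)) * (1 - s / T) ^ (m + 1)) has_real_derivative
           - (T / (m + 1)) * ((m + 1) * ((1 - s / T) ^ m * (- 1 / T)))) (at s)"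
          by (auto intro!: derivative_eq_intros simp del: power_Suc)
        also have "- (T / (m + 1)) * ((m + 1) * ((1 - s / T) ^ m * (- 1 / T))) = (1 - s / T) ^ m"
          using T by (simp add: divide_simps del: of_nat_Suc)
        finally show "((\<lambda>s. - (T / (m + 1)) * (1 - s / T) ^ (m + 1)) has_vector_derivative (1 - s / T) ^ m)
            (at s within {t..T})"
          by (simp only: has_real_derivative_iff_has_vector_derivative[symmetric] has_field_derivative_at_within)
      qed
      then have "((\<lambda>s. (1 - s / T) ^ m) has_integral T / (m + 1) * (1 - t / T) ^ (m + 1)) {t..T}"
        using T by simp
      then have "(?a has_integral T / (m + 1) * (1 - t / T) ^ (m + 1)) {t..T}"
        by (rule has_integral_eq[rotated]) (use T in \<open>auto simp: max_def field_simps\<close>)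
      then have "(?g has_integral (T - t) powr (\<gamma> - 1) * (T / (m + 1) * (1 - t / T) ^ (m + 1))) {t..T}"
        by (rule has_integral_mult_right)
      then have "(LINT s:{t..T}|lebesgue. ?g s)
          = (T - t) powr (\<gamma> - 1) * (T / (m + 1) * (1 - t / T) ^ (m + 1))"
        unfolding set_lebesgue_integral_eq_integral(2)[OF g] by (rule integral_unique)
      also have "\<dots> = (T powr (\<gamma> - 1) * T powr 1)
          * ((1 - t / T) powr (\<gamma> - 1) * (1 - t / T) powr (m + 1)) / (m + 1)"
      proof -
        have "(T - t) powr (\<gamma> - 1) = T powr (\<gamma> - 1) * (1 - t / T) powr (\<gamma> - 1)"
          using powr_mult[of T "1 - t / T" "\<gamma> - 1"] T by (simp add: right_diff_distrib)
        moreover have "(1 - t / T) ^ (m + 1) = (1 - t / T) powr (m + 1)"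
          using T \<open>t < T\<close> by (subst powr_realpow[symmetric]) auto
        ultimately show ?thesis using T by simp
      qed
      also have "\<dots> = T powr \<gamma> * (1 - t / T) powr (m + \<gamma>) / (m + 1)"
        by (simp only: powr_add[symmetric]) (simp add: algebra_simps)
      finally show ?thesis .
    qed
    have "(LINT s:{t..T}|lebesgue. ?g s) \<le> (LINT s:{t..T}|lebesgue. ?f s)"
      unfolding set_lebesgue_integral_def
    proof (rule integral_mono_AE)
      show "integrable lebesgue (\<lambda>s. indicator {t..T} s *\<^sub>R ?g s)"
        using g by (simp only: set_integrable_def)
      show "integrable lebesgue (\<lambda>s. indicator {t..T} s *\<^sub>R ?f s)"
        using f by (simp only: set_integrable_def)
      have "AE s in lebesgue. s \<noteq> t" by (intro AE_completion AE_lborel_singleton)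
      then show "AE s in lebesgue. indicator {t..T} s *\<^sub>R ?g s \<le> indicator {t..T} s *\<^sub>R ?f s"
      proof eventually_elim
        case (elim s)
        then show ?case
          using \<gamma> by (auto simp: indicator_def intro!: mult_right_mono powr_mono2')
      qed
    qed
    also have "(LINT s:{t..T}|lebesgue. ?f s) = (LINT s:{s. t < s \<and> ereal s < \<infinity>}|lebesgue. ?f s)"
      unfolding set_lebesgue_integral_def
      by (intro Bochner_Integration.integral_cong refl)
         (use T m in \<open>auto simp: indicator_def max_def field_simps\<close>)
    finally have "(LINT s:{t..T}|lebesgue. ?g s) / Gamma \<gamma> \<le> frac_int \<infinity> \<gamma> ?a t"
      unfolding frac_int_def using \<gamma> by (intro divide_right_mono) (auto simp: Gamma_real_pos less_imp_le)
    then show ?thesis unfolding gval by (simp add: ac_simps)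
  qed
qed

lemma frac_int_mult_const:
  "frac_int T \<gamma> (\<lambda>s. a s * c) t = frac_int T \<gamma> a t * c"
proof -
  have "(\<lambda>s. (s - t) powr (\<gamma> - 1) * (a s * c)) = (\<lambda>s. ((s - t) powr (\<gamma> - 1) * a s) * c)"
    by (simp add: mult.assoc)
  then show ?thesis by (simp only: frac_int_def set_integral_mult_left) simp
qed


section \<open>The cut-off in space\<close>

text \<open>
  A bump in \<open>s\<close>: the term \<open>s / n\<close> cuts off large \<open>s\<close>, the exponential, having coefficient
  \<open>2 > 1\<close>, cuts off a neighbourhood of \<open>0\<close>, and both disappear as \<open>n \<longlongrightarrow> \<infinity>\<close> for fixed \<open>s > 0\<close>.
  The profile before taking the positive part is smooth on the whole line, so powers of the bump
  are differentiable as often as their exponent permits.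
\<close>
definition annulus :: "real \<Rightarrow> real \<Rightarrow> real" where
  "annulus n s = max 0 (1 - s / n - 2 * exp (- n * s))"

lemma annulus_nonneg: "0 \<le> annulus n s"
  by (simp add: annulus_def)

lemma annulus_pos_imp:
  assumes n: "1 \<le> n" and pos: "0 < annulus n s"
  shows "1 / (2 * n) < s" "s < n"
proof -
  have r: "2 * exp (- n * s) < 1 - s / n" using pos unfolding annulus_def by linarith
  moreover have "1 - n * s \<le> exp (- n * s)"
    using exp_ge_add_one_self[of "- n * s"] by simp
  ultimately have 1: "1 + s / n < 2 * (n * s)" by linarith
  have s: "0 < s"
  proof (rule ccontr)
    assume "\<not> 0 < s"
    then have ns: "n * s \<le> s" using mult_right_mono_neg[of 1 n s] n by linarith
    then have "s \<le> s / n" using n by (simp add: pos_le_divide_eq mult.commute)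
    with 1 ns \<open>\<not> 0 < s\<close> show False by linarith
  qed
  have "0 \<le> s / n" using s n by simp
  with 1 have "1 < 2 * (n * s)" by linarith
  then show "1 / (2 * n) < s" using n by (simp add: pos_divide_less_eq mult.commute mult.left_commute)
  have "s / n < 1" using r exp_gt_zero[of "- n * s"] by linarith
  then show "s < n" using n by (simp add: pos_divide_less_eq)
qed

lemma annulus_le_1:
  assumes n: "1 \<le> n" shows "annulus n s \<le> 1"
proof (cases "0 < annulus n s")
  case True
  have "0 < 1 / (2 * n)" using n by simp
  with annulus_pos_imp(1)[OF n True] have "0 < s" by linarith
  then have "0 \<le> s / n" using n by simp
  then show ?thesis using exp_gt_zero[of "- n * s"] unfolding annulus_def by linarith
qed (simp)

lemma annulus_tendsto_1:
  assumes "0 < s" shows "(\<lambda>j. annulus (real (Suc j)) s) \<longlonglongrightarrow> 1"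
proof -
  have 1: "(\<lambda>j. s / real j) \<longlonglongrightarrow> 0" by (rule lim_const_over_n)
  have "(\<lambda>j. exp (- s) ^ j) \<longlonglongrightarrow> 0"
    using assms by (intro LIMSEQ_realpow_zero) auto
  moreover have "exp (- s) ^ j = exp (- real j * s)" for j
    by (simp add: exp_of_nat_mult[symmetric])
  ultimately have 2: "(\<lambda>j. exp (- real j * s)) \<longlonglongrightarrow> 0" by simp
  have "(\<lambda>j. annulus (real j) s) \<longlonglongrightarrow> max 0 (1 - 0 - 2 * 0)"
    unfolding annulus_def by (intro tendsto_max tendsto_diff tendsto_mult tendsto_const 1 2)
  from LIMSEQ_Suc[OF this] show ?thesis by simp
qed

definition annulus_slope :: "real \<Rightarrow> real \<Rightarrow> real" where
  "annulus_slope n s = 2 * n * exp (- n * s) - 1 / n"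

definition annulus_slope_deriv :: "real \<Rightarrow> real \<Rightarrow> real" where
  "annulus_slope_deriv n s = - 2 * n\<^sup>2 * exp (- n * s)"

text \<open>First and second derivative of \<open>annulus n s ^ (k + 3)\<close> in \<open>s\<close>.\<close>
definition annulus_power_deriv :: "nat \<Rightarrow> real \<Rightarrow> real \<Rightarrow> real" where
  "annulus_power_deriv k n s = real (k + 3) * (annulus n s ^ (k + 2) * annulus_slope n s)"

definition annulus_power_deriv2 :: "nat \<Rightarrow> real \<Rightarrow> real \<Rightarrow> real" where
  "annulus_power_deriv2 k n s = real (k + 3) * (real (k + 2) * annulus n s ^ (k + 1) * annulus_slope n s * annulus_slope n s
     + annulus_slope_deriv n s * annulus n s ^ (k + 2))"

lemma DERIV_annulus_power:
  assumes "1 \<le> n"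
  shows "((\<lambda>s. annulus n s ^ (j + 2)) has_real_derivative
    real (j + 2) * annulus n s ^ (j + 1) * annulus_slope n s) (at s)"
  unfolding annulus_def annulus_slope_def
  by (rule DERIV_pospart_power) (use assms in \<open>auto intro!: derivative_eq_intros\<close>)

lemma DERIV_annulus_slope: "(annulus_slope n has_real_derivative annulus_slope_deriv n s) (at s)"
  unfolding annulus_slope_def[abs_def] annulus_slope_deriv_def
  by (auto intro!: derivative_eq_intros simp: power2_eq_square)

lemma DERIV_annulus_power_3:
  assumes "1 \<le> n"
  shows "((\<lambda>s. annulus n s ^ (k + 3)) has_real_derivative annulus_power_deriv k n s) (at s)"
  using DERIV_annulus_power[OF assms, of "k + 1" s]
  by (simp add: annulus_power_deriv_def numeral_eq_Suc mult.assoc)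

lemma DERIV_annulus_power_deriv:
  assumes "1 \<le> n"
  shows "(annulus_power_deriv k n has_real_derivative annulus_power_deriv2 k n s) (at s)"
  unfolding annulus_power_deriv_def[abs_def] annulus_power_deriv2_def
  by (intro DERIV_cmult DERIV_mult DERIV_annulus_power[OF assms] DERIV_annulus_slope)

lemma continuous_on_annulus: "1 \<le> n \<Longrightarrow> continuous_on A (annulus n)"
  unfolding annulus_def by (intro continuous_intros) auto

lemma continuous_on_annulus_power_deriv2: "1 \<le> n \<Longrightarrow> continuous_on A (annulus_power_deriv2 k n)"
  unfolding annulus_power_deriv2_def annulus_slope_def annulus_slope_deriv_def by (intro continuous_intros continuous_on_annulus) auto

lemma C2_fun_annulus_koranyi4:
  "1 \<le> n \<Longrightarrow> C2_fun (\<lambda>\<xi>. annulus n (koranyi4 \<xi>) ^ (k + 3))"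
  by (rule C2_fun_compose[OF C2_fun_koranyi4 DERIV_annulus_power_3 DERIV_annulus_power_deriv continuous_on_annulus_power_deriv2])

text \<open>
  Two derivatives of \<open>annulus ^ (k + 3)\<close> cost two powers of \<open>annulus\<close>. What remains after factoring
  out \<open>annulus ^ (k + 1)\<close> is continuous on the compact range of \<open>koranyi4\<close> over the support, because
  that range stays away from \<open>0\<close>; so it is bounded. The scalar \<open>a\<close> will be the value of the time
  cut-off.
\<close>
lemma L_H_annulus_bound:
  assumes n: "1 \<le> n"
  shows "\<exists>C\<ge>0. \<forall>a\<ge>0. \<forall>\<xi> :: 'n::finite heis.
    \<bar>L_H lam (\<lambda>\<eta>. a * annulus n (koranyi4 \<eta>) ^ (k + 3)) \<xi>\<bar> \<le> C * (a * annulus n (koranyi4 \<xi>) ^ (k + 1))"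
proof -
  define e where "e = - mu TYPE('n) lam / 2"
  define G' where "G' = (\<lambda>s. e * s powr (e - 1) * annulus_power_deriv k n s + annulus_power_deriv2 k n s * s powr e)"
  \<comment> \<open>\<open>L\<^sub>H\<close> of the bump is \<open>- hor_sq * annulus ^ (k + 1) * B\<close>.\<close>
  define B where "B = (\<lambda>s. 16 * s * (e * s powr (e - 1) * (real (k + 3) * annulus n s * annulus_slope n s)
      + (real (k + 3) * (real (k + 2) * (annulus_slope n s * annulus_slope n s) + annulus_slope_deriv n s * annulus n s)) * s powr e)
      + (8 * real CARD('n) + 16) * (s powr e * (real (k + 3) * annulus n s * annulus_slope n s)))"
  have "compact (B ` {1 / (2 * n)..n})"
    unfolding B_def annulus_slope_def annulus_slope_deriv_def using n
    by (intro compact_continuous_image continuous_intros continuous_on_annulus) auto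
  then obtain M where M: "M > 0" "\<And>s. s \<in> {1 / (2 * n)..n} \<Longrightarrow> \<bar>B s\<bar> \<le> M"
    using compact_imp_bounded[of "B ` {1 / (2 * n)..n}"] by (auto simp: bounded_pos)
  have LH: "L_H lam (\<lambda>\<eta>. a * annulus n (koranyi4 \<eta>) ^ (k + 3)) \<xi>
      = - hor_sq \<xi> * (a * annulus n (koranyi4 \<xi>) ^ (k + 1) * B (koranyi4 \<xi>))" for a and \<xi> :: "'n heis"
  proof -
    let ?s = "koranyi4 \<xi>"
    have G: "((\<lambda>s. s powr e * annulus_power_deriv k n s) has_real_derivative G' ?s) (at ?s)"
    proof (cases "0 < ?s")
      case True
      then show ?thesis unfolding G'_def
        by (intro DERIV_mult DERIV_annulus_power_deriv[OF n] has_real_derivative_powr)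
    next
      case False
      \<comment> \<open>At the origin the weight is singular, but the bump vanishes nearby.\<close>
      have z: "annulus n s = 0" if "s < 1 / (2 * n)" for s
        using annulus_pos_imp(1)[OF n, of s] annulus_nonneg[of n s] that by force
      have s: "?s < 1 / (2 * n)" using False n divide_pos_pos[of 1 "2 * n"] by linarith
      have "((\<lambda>s. s powr e * annulus_power_deriv k n s) has_real_derivative 0) (at ?s)"
        by (rule has_field_derivative_transform_within_open[where S="{..<1 / (2 * n)}" and f="\<lambda>_. 0"])
           (use s z in \<open>auto simp: annulus_power_deriv_def\<close>)
      moreover have "G' ?s = 0" using z[OF s] by (simp add: G'_def annulus_power_deriv_def annulus_power_deriv2_def)
      ultimately show ?thesis by simp
    qed
    have "((\<lambda>s. s powr (- mu TYPE('n) lam / 2) * (a * annulus_power_deriv k n s)) has_real_derivative a * G' ?s) (at ?s)"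
      using DERIV_cmult[OF G, of a] by (simp add: e_def mult_ac)
    from L_H_radial[where h="\<lambda>s. a * annulus n s ^ (k + 3)", OF DERIV_cmult[OF DERIV_annulus_power_3[OF n]] this]
    have "L_H lam (\<lambda>\<eta>. a * annulus n (koranyi4 \<eta>) ^ (k + 3)) \<xi> = - hor_sq \<xi> * (16 * ?s * (a * G' ?s)
       + (8 * real CARD('n) + 16) * (?s powr e * (a * annulus_power_deriv k n ?s)))"
      by (simp add: e_def)
    also have "16 * ?s * (a * G' ?s) + (8 * real CARD('n) + 16) * (?s powr e * (a * annulus_power_deriv k n ?s))
      = a * annulus n ?s ^ (k + 1) * B ?s"
      by (simp add: G'_def B_def annulus_power_deriv_def annulus_power_deriv2_def power_add algebra_simps)
    finally show ?thesis .
  qed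
  show ?thesis
  proof (intro exI[of _ "(n + 1) * M"] conjI allI impI)
    show "0 \<le> (n + 1) * M" using n M by simp
    fix a :: real and \<xi> :: "'n heis" assume a: "0 \<le> a"
    let ?s = "koranyi4 \<xi>"
    show "\<bar>L_H lam (\<lambda>\<eta>. a * annulus n (koranyi4 \<eta>) ^ (k + 3)) \<xi>\<bar>
        \<le> (n + 1) * M * (a * annulus n ?s ^ (k + 1))"
    proof (cases "0 < annulus n ?s")
      case True
      note s = annulus_pos_imp[OF n True]
      have "hor_sq \<xi> \<le> hor_sq \<xi> * hor_sq \<xi> + 1"
        using sum_squares_bound[of "hor_sq \<xi>" 1] hor_sq_nonneg[of \<xi>] by (simp add: power2_eq_square)
      also have "\<dots> \<le> ?s + 1" by (simp add: koranyi4_def)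
      finally have h: "hor_sq \<xi> \<le> n + 1" using s by simp
      have "\<bar>L_H lam (\<lambda>\<eta>. a * annulus n (koranyi4 \<eta>) ^ (k + 3)) \<xi>\<bar>
          = (hor_sq \<xi> * \<bar>B ?s\<bar>) * (a * annulus n ?s ^ (k + 1))"
        using a annulus_nonneg[of n ?s] hor_sq_nonneg[of \<xi>] by (simp add: LH abs_mult)
      also have "\<dots> \<le> ((n + 1) * M) * (a * annulus n ?s ^ (k + 1))"
        using h M(2)[of ?s] s a n annulus_nonneg[of n ?s] hor_sq_nonneg[of \<xi>]
        by (intro mult_right_mono mult_mono) auto
      finally show ?thesis .
    next
      case False
      then have "annulus n ?s = 0" using annulus_nonneg[of n ?s] by linarith
      then show ?thesis by (simp add: LH)
    qed
  qed
qed

lemma annulus_koranyi4_measurable: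
  assumes "1 \<le> n"
  shows "(\<lambda>\<xi>::'n::finite heis. annulus n (koranyi4 \<xi>) ^ m) \<in> borel_measurable lebesgue"
proof -
  have "continuous_on UNIV (koranyi4 :: 'n heis \<Rightarrow> real)"
    by (intro C1_fun_continuous C2_fun_C1 C2_fun_koranyi4)
  then have "continuous_on UNIV (\<lambda>\<xi>::'n heis. annulus n (koranyi4 \<xi>))"
    by (rule continuous_on_compose2[OF continuous_on_annulus[OF assms, of UNIV]]) simp
  then have "(\<lambda>\<xi>::'n heis. annulus n (koranyi4 \<xi>) ^ m) \<in> borel_measurable lborel"
    by (intro borel_measurable_power) (simp add: borel_measurable_continuous_onI)
  then show ?thesis by (rule measurable_completion)
qed

text \<open>
  The bumps exhaust the complement of the origin, which is a null set, so dominated convergence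
  keeps the mass of \<open>g\<close> positive on some annulus.
\<close>
lemma annulus_captures_mass:
  fixes g :: "'n::finite heis \<Rightarrow> real"
  assumes g: "integrable lebesgue g" and pos: "0 < (LINT \<xi>|lebesgue. g \<xi>)"
  obtains n where "1 \<le> n" "0 < (LINT \<xi>|lebesgue. g \<xi> * annulus n (koranyi4 \<xi>) ^ m)"
proof -
  let ?s = "\<lambda>j \<xi>. g \<xi> * annulus (real (Suc j)) (koranyi4 \<xi>) ^ m"
  have "(\<lambda>j. LINT \<xi>|lebesgue. ?s j \<xi>) \<longlonglongrightarrow> (LINT \<xi>|lebesgue. g \<xi>)"
  proof (rule integral_dominated_convergence[where w="\<lambda>\<xi>. \<bar>g \<xi>\<bar>"])
    show "g \<in> borel_measurable lebesgue" using g by (rule borel_measurable_integrable)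
    then show "?s j \<in> borel_measurable lebesgue" for j
      by (intro borel_measurable_times annulus_koranyi4_measurable) simp_all
    show "integrable lebesgue (\<lambda>\<xi>. \<bar>g \<xi>\<bar>)" using g by (rule integrable_abs)
    have "AE \<xi> in lebesgue. \<xi> \<noteq> (0 :: 'n heis)" by (intro AE_completion AE_lborel_singleton)
    then show "AE \<xi> in lebesgue. (\<lambda>j. ?s j \<xi>) \<longlonglongrightarrow> g \<xi>"
    proof eventually_elim
      case (elim \<xi>)
      then have "0 < koranyi4 \<xi>" using koranyi4_nonneg[of \<xi>] koranyi4_eq_0_iff[of \<xi>] by linarith
      from tendsto_mult_left[OF tendsto_power[OF annulus_tendsto_1[OF this]], of "g \<xi>" m]
      show ?case by simp
    qed
    show "AE \<xi> in lebesgue. norm (?s j \<xi>) \<le> \<bar>g \<xi>\<bar>" for j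
    proof (intro AE_I2)
      fix \<xi> :: "'n heis"
      have "annulus (real (Suc j)) (koranyi4 \<xi>) ^ m \<le> 1"
        by (intro power_le_one annulus_nonneg annulus_le_1) simp
      then show "norm (?s j \<xi>) \<le> \<bar>g \<xi>\<bar>"
        using annulus_nonneg by (simp add: abs_mult power_abs mult_left_le)
    qed
  qed
  from order_tendstoD(1)[OF this pos] obtain j where "0 < (LINT \<xi>|lebesgue. ?s j \<xi>)"
    by (auto simp: eventually_sequentially)
  then show thesis by (intro that[of "real (Suc j)"]) auto
qed


section \<open>Absorption of the linear terms\<close>

text \<open>
  The parameter \<open>A\<close> keeps track of how the remainder shrinks as the coefficient of the absorbing
  power grows.
\<close>
lemma scaled_Young:
  fixes p :: real
  assumes p: "1 < p" and A: "0 < A" and "0 \<le> B" "0 \<le> x"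
  shows "B * x \<le> A * x powr p + (B * A powr (- 1 / p)) powr (p / (p - 1))"
proof -
  let ?q = "p / (p - 1)"
  have "(A powr (1 / p) * x) * (B * A powr (- 1 / p))
     \<le> (A powr (1 / p) * x) powr p / p + (B * A powr (- 1 / p)) powr ?q / ?q"
    using assms by (intro Youngs_inequality) (auto simp: field_simps)
  also have "\<dots> \<le> (A powr (1 / p) * x) powr p + (B * A powr (- 1 / p)) powr ?q"
  proof (intro add_mono)
    have div: "y / c \<le> y" if "0 \<le> y" "1 \<le> c" for y c :: real
      using that mult_left_mono[of 1 c y] by (simp add: divide_le_eq)
    show "(A powr (1 / p) * x) powr p / p \<le> (A powr (1 / p) * x) powr p"
      "(B * A powr (- 1 / p)) powr ?q / ?q \<le> (B * A powr (- 1 / p)) powr ?q"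
      using p by (intro div; simp)+
  qed
  also have "(A powr (1 / p) * x) powr p = A * x powr p"
    using assms by (simp add: powr_mult powr_powr)
  also have "(A powr (1 / p) * x) * (B * A powr (- 1 / p)) = (A powr (1 / p) * A powr (- 1 / p)) * (B * x)"
    by (simp add: mult_ac)
  also have "A powr (1 / p) * A powr (- 1 / p) = 1"
    using A by (simp add: powr_add[symmetric])
  finally show ?thesis by simp
qed

lemma powr_bounds_on_annulus:
  fixes n e :: real
  assumes n: "1 \<le> n"
  obtains c C where "0 < c" "0 < C" "\<And>s. 1 / (2 * n) < s \<Longrightarrow> s < n \<Longrightarrow> c \<le> s powr e \<and> s powr e \<le> C"
proof -
  have "continuous_on {1 / (2 * n)..n} (\<lambda>s. s powr e)"
    using n by (intro continuous_intros) auto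
  moreover have ne: "{1 / (2 * n)..n} \<noteq> {}"
  proof -
    have "1 / (2 * n) \<le> n" using n mult_mono[of 1 n 1 n] by (simp add: pos_divide_le_eq)
    then show ?thesis by simp
  qed
  ultimately obtain a b where a: "a \<in> {1 / (2 * n)..n}" "\<And>s. s \<in> {1 / (2 * n)..n} \<Longrightarrow> a powr e \<le> s powr e"
    and b: "b \<in> {1 / (2 * n)..n}" "\<And>s. s \<in> {1 / (2 * n)..n} \<Longrightarrow> s powr e \<le> b powr e"
    using continuous_attains_inf[OF compact_Icc ne] continuous_attains_sup[OF compact_Icc ne] by blast
  have "0 < a" "0 < b" using a(1) b(1) n by (auto simp: order.strict_trans2[of 0 "1 / (2 * n)"])
  then show thesis using a(2) b(2) by (intro that[of "a powr e" "b powr e"]) auto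
qed

text \<open>
  Let \<open>\<theta> = 1 - t / T\<close> and let \<open>\<kappa>\<close> be the value of the bump. The linear terms are at most
  \<open>V * \<theta> ^ (k + 2) * \<kappa> ^ (k + 1)\<close> up to a constant, while the nonlinear one is at least
  \<open>T powr \<gamma> * \<theta> powr (k + 3 + \<gamma>) * \<kappa> ^ (k + 3) * V powr p\<close> up to a constant. As \<open>\<theta>, \<kappa> \<le> 1\<close>, the
  condition on \<open>k\<close> is what makes the \<open>p\<close>-th power of the former coefficient dominated by
  the latter without \<open>T powr \<gamma>\<close>. Young's inequality therefore leaves a remainder without any
  singularity where the cut-offs vanish, and the large factor \<open>T powr \<gamma>\<close> turns into the small
  factor \<open>T powr (- \<gamma> / (p - 1))\<close>.
\<close>
lemma nonlinear_term_absorbs_linear_terms: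
  fixes lam \<gamma> p n :: real
  assumes \<gamma>: "0 < \<gamma>" "\<gamma> < 1" and p: "1 < p" and n: "1 \<le> n" and k: "3 \<le> real k * (p - 1)"
  obtains C where "0 \<le> C"
    "\<And>T t V (\<xi> :: 'n::finite heis). 1 \<le> T \<Longrightarrow> 0 \<le> t \<Longrightarrow> 0 \<le> V \<Longrightarrow>
      V * (koranyi \<xi> powr (- 2 * mu TYPE('n) lam) * (\<bar>decay_deriv k T t\<bar> * annulus n (koranyi4 \<xi>) ^ (k + 3))
           + \<bar>L_H lam (\<lambda>\<eta>. decay k T t * annulus n (koranyi4 \<eta>) ^ (k + 3)) \<xi>\<bar>)
      \<le> koranyi \<xi> powr (- (p + 1) * mu TYPE('n) lam) * V powr p
          * (frac_int \<infinity> \<gamma> (decay k T) t * annulus n (koranyi4 \<xi>) ^ (k + 3))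
        + C * T powr (- \<gamma> / (p - 1)) * (indicator {0..T} t * indicator {\<eta>. koranyi4 \<eta> \<le> n} \<xi>)"
proof -
  let ?m = "mu TYPE('n) lam"
  obtain C0 where C0: "0 \<le> C0" "\<And>a (\<xi> :: 'n heis). 0 \<le> a \<Longrightarrow>
     \<bar>L_H lam (\<lambda>\<eta>. a * annulus n (koranyi4 \<eta>) ^ (k + 3)) \<xi>\<bar> \<le> C0 * (a * annulus n (koranyi4 \<xi>) ^ (k + 1))"
    using L_H_annulus_bound[OF n] by blast
  obtain W where W: "0 < W" "\<And>s. 1 / (2 * n) < s \<Longrightarrow> s < n \<Longrightarrow> s powr (- 2 * ?m / 4) \<le> W"
    using powr_bounds_on_annulus[OF n, of "- 2 * ?m / 4"] by metis
  obtain w where w: "0 < w" "\<And>s. 1 / (2 * n) < s \<Longrightarrow> s < n \<Longrightarrow> w \<le> s powr (- (p + 1) * ?m / 4)"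
    using powr_bounds_on_annulus[OF n, of "- (p + 1) * ?m / 4"] by metis
  define c where "c = w / ((real (k + 3) + 1) * Gamma \<gamma>)"
  define B where "B = W * real (k + 3) + C0"
  define C where "C = (B * c powr (- 1 / p)) powr (p / (p - 1))"
  have c: "0 < c" using w \<gamma> by (simp add: c_def Gamma_real_pos add_pos_nonneg)
  have B: "0 \<le> B" using W C0 by (simp add: B_def)
  show thesis
  proof (rule that)
    show "0 \<le> C" by (simp add: C_def)
    fix T t V :: real and \<xi> :: "'n heis"
    assume T: "1 \<le> T" and t: "0 \<le> t" and V: "0 \<le> V"
    define \<theta> where "\<theta> = max 0 (1 - t / T)"
    define \<kappa> where "\<kappa> = annulus n (koranyi4 \<xi>)"
    have \<kappa>0: "0 \<le> \<kappa>" and \<kappa>1: "\<kappa> \<le> 1"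
      using annulus_nonneg annulus_le_1[OF n] by (simp_all add: \<kappa>_def)
    have \<theta>0: "0 \<le> \<theta>" and \<theta>1: "\<theta> \<le> 1" using T t by (auto simp: \<theta>_def)
    have dec: "decay k T t = \<theta> ^ (k + 3)" "\<bar>decay_deriv k T t\<bar> = real (k + 3) / T * \<theta> ^ (k + 2)"
      using T \<theta>0 by (simp_all add: decay_def decay_deriv_def \<theta>_def abs_mult)
    let ?L = "\<bar>L_H lam (\<lambda>\<eta>. decay k T t * annulus n (koranyi4 \<eta>) ^ (k + 3)) \<xi>\<bar>"
    have L: "?L \<le> C0 * (\<theta> ^ (k + 3) * \<kappa> ^ (k + 1))"
      using C0(2)[of "\<theta> ^ (k + 3)" \<xi>] \<theta>0 by (simp add: dec \<kappa>_def)
    have fr0: "0 \<le> frac_int \<infinity> \<gamma> (decay k T) t"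
      by (rule frac_int_nonneg[OF \<gamma>(1)]) (simp add: decay_def)
    show "V * (koranyi \<xi> powr (- 2 * ?m) * (\<bar>decay_deriv k T t\<bar> * annulus n (koranyi4 \<xi>) ^ (k + 3)) + ?L)
      \<le> koranyi \<xi> powr (- (p + 1) * ?m) * V powr p
          * (frac_int \<infinity> \<gamma> (decay k T) t * annulus n (koranyi4 \<xi>) ^ (k + 3))
        + C * T powr (- \<gamma> / (p - 1)) * (indicator {0..T} t * indicator {\<eta>. koranyi4 \<eta> \<le> n} \<xi>)"
    proof (cases "0 < \<theta> \<and> 0 < \<kappa>")
      case False
      then have z: "\<theta> = 0 \<or> \<kappa> = 0" using \<theta>0 \<kappa>0 by linarith
      then have "\<theta> ^ (k + 3) * \<kappa> ^ (k + 1) = 0" by (auto simp: power_0_left)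
      with L have "?L \<le> 0" by (simp only: mult_zero_right)
      then have L0: "?L = 0" by (simp only: abs_le_zero_iff abs_zero)
      have d0: "\<bar>decay_deriv k T t\<bar> * annulus n (koranyi4 \<xi>) ^ (k + 3) = 0"
        using z by (auto simp: dec \<kappa>_def)
      show ?thesis
        unfolding L0 d0 mult_zero_right add_0_right
        using fr0 annulus_nonneg
        by (intro add_nonneg_nonneg mult_nonneg_nonneg) (auto simp: C_def)
    next
      case True
      then have s: "1 / (2 * n) < koranyi4 \<xi>" "koranyi4 \<xi> < n"
        using annulus_pos_imp[OF n] by (auto simp: \<kappa>_def)
      have "0 < 1 - t / T" using True by (simp add: \<theta>_def max_def split: if_splits)
      then have tT: "t < T" and \<theta>: "\<theta> = 1 - t / T" using T by (auto simp: \<theta>_def pos_divide_less_eq)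
      define A where "A = c * T powr \<gamma>"
      define x where "x = V * (\<theta> powr ((real (k + 3) + \<gamma>) / p) * \<kappa> powr (real (k + 3) / p))"
      have A: "0 < A" using c T by (simp add: A_def)
      have x: "0 \<le> x" using V by (simp add: x_def)
      have kp: "real k + 3 \<le> real k * p" using k by (simp add: algebra_simps)
      have "\<theta> ^ (k + 2) = \<theta> powr real (k + 2)" using True by (intro powr_realpow[symmetric]) simp
      also have "\<dots> \<le> \<theta> powr ((real (k + 3) + \<gamma>) / p)"
        using True \<theta>1 kp p \<gamma> by (intro powr_mono') (auto simp: pos_divide_le_eq algebra_simps)
      finally have e1: "\<theta> ^ (k + 2) \<le> \<theta> powr ((real (k + 3) + \<gamma>) / p)" .
      have "\<kappa> ^ (k + 1) = \<kappa> powr real (k + 1)" using True by (intro powr_realpow[symmetric]) simp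
      also have "\<dots> \<le> \<kappa> powr (real (k + 3) / p)"
        using True \<kappa>1 kp p by (intro powr_mono') (auto simp: pos_divide_le_eq algebra_simps)
      finally have e2: "\<kappa> ^ (k + 1) \<le> \<kappa> powr (real (k + 3) / p)" .
      have "koranyi \<xi> powr (- 2 * ?m) * (\<bar>decay_deriv k T t\<bar> * annulus n (koranyi4 \<xi>) ^ (k + 3))
          \<le> W * (real (k + 3) * \<theta> ^ (k + 2) * \<kappa> ^ (k + 1))"
      proof (rule mult_mono)
        show "koranyi \<xi> powr (- 2 * ?m) \<le> W" using W(2)[OF s] by (simp add: koranyi_powr)
        have "real (k + 3) / T \<le> real (k + 3)" using T by (simp add: divide_le_eq mult_le_cancel_left1)
        moreover have "\<kappa> ^ (k + 3) \<le> \<kappa> ^ (k + 1)" using \<kappa>0 \<kappa>1 by (intro power_decreasing) auto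
        ultimately show "\<bar>decay_deriv k T t\<bar> * annulus n (koranyi4 \<xi>) ^ (k + 3)
            \<le> real (k + 3) * \<theta> ^ (k + 2) * \<kappa> ^ (k + 1)"
          unfolding dec \<kappa>_def[symmetric] using \<theta>0 \<kappa>0 T by (intro mult_mono) auto
      qed (use W annulus_nonneg in auto)
      moreover have "?L \<le> C0 * (\<theta> ^ (k + 2) * \<kappa> ^ (k + 1))"
      proof -
        have "\<theta> ^ (k + 3) \<le> \<theta> ^ (k + 2)" using \<theta>0 \<theta>1 by (intro power_decreasing) auto
        then show ?thesis
          using \<kappa>0 C0(1) by (intro order.trans[OF L] mult_left_mono mult_right_mono) auto
      qed
      ultimately have "koranyi \<xi> powr (- 2 * ?m) * (\<bar>decay_deriv k T t\<bar> * annulus n (koranyi4 \<xi>) ^ (k + 3)) + ?L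
          \<le> B * (\<theta> ^ (k + 2) * \<kappa> ^ (k + 1))"
        by (simp add: B_def algebra_simps)
      also have "\<dots> \<le> B * (\<theta> powr ((real (k + 3) + \<gamma>) / p) * \<kappa> powr (real (k + 3) / p))"
        using B \<kappa>0 by (intro mult_left_mono mult_mono e1 e2) auto
      finally have "V * (koranyi \<xi> powr (- 2 * ?m) * (\<bar>decay_deriv k T t\<bar> * annulus n (koranyi4 \<xi>) ^ (k + 3)) + ?L)
          \<le> V * (B * (\<theta> powr ((real (k + 3) + \<gamma>) / p) * \<kappa> powr (real (k + 3) / p)))"
        using V by (rule mult_left_mono)
      also have "\<dots> = B * x" by (simp add: x_def)
      also have "\<dots> \<le> A * x powr p + (B * A powr (- 1 / p)) powr (p / (p - 1))"
        by (rule scaled_Young[OF p A B x])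
      also have "(B * A powr (- 1 / p)) powr (p / (p - 1)) = C * T powr (- \<gamma> / (p - 1))"
      proof -
        have "A powr (- 1 / p) = c powr (- 1 / p) * T powr (- \<gamma> / p)"
          by (simp add: A_def powr_mult powr_powr)
        then have "(B * A powr (- 1 / p)) powr (p / (p - 1)) = C * (T powr (- \<gamma> / p)) powr (p / (p - 1))"
          by (simp add: C_def powr_mult mult.assoc)
        also have "(T powr (- \<gamma> / p)) powr (p / (p - 1)) = T powr (- \<gamma> / (p - 1))"
          using p by (simp add: powr_powr)
        finally show ?thesis .
      qed
      also have "\<dots> = C * T powr (- \<gamma> / (p - 1)) * (indicator {0..T} t * indicator {\<eta>. koranyi4 \<eta> \<le> n} \<xi>)"
        using t tT s by simp
      also have "A * x powr p \<le> koranyi \<xi> powr (- (p + 1) * ?m) * V powr p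
          * (frac_int \<infinity> \<gamma> (decay k T) t * annulus n (koranyi4 \<xi>) ^ (k + 3))"
      proof -
        have "x powr p = V powr p * (\<theta> powr (real (k + 3) + \<gamma>) * \<kappa> ^ (k + 3))"
          using p True by (simp add: x_def powr_mult powr_powr powr_realpow[symmetric])
        then have "A * x powr p = w * V powr p
            * (T powr \<gamma> * \<theta> powr (real (k + 3) + \<gamma>) / ((real (k + 3) + 1) * Gamma \<gamma>) * \<kappa> ^ (k + 3))"
          by (simp add: A_def c_def)
        also have "\<dots> \<le> koranyi \<xi> powr (- (p + 1) * ?m) * V powr p
            * (frac_int \<infinity> \<gamma> (decay k T) t * \<kappa> ^ (k + 3))"
        proof (intro mult_mono mult_right_mono)
          show "w \<le> koranyi \<xi> powr (- (p + 1) * ?m)" using w(2)[OF s] by (simp add: koranyi_powr)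
          show "T powr \<gamma> * \<theta> powr (real (k + 3) + \<gamma>) / ((real (k + 3) + 1) * Gamma \<gamma>)
              \<le> frac_int \<infinity> \<gamma> (decay k T) t"
            using frac_int_decay_ge[OF \<gamma>, of T t "k + 3"] T tT
            unfolding decay_def[abs_def] \<theta> by simp
        qed (use \<kappa>0 fr0 \<gamma> in \<open>auto simp: Gamma_real_pos less_imp_le\<close>)
        finally show ?thesis by (simp only: \<kappa>_def)
      qed
      finally show ?thesis by simp
    qed
  qed
qed


section \<open>The mass balance and its contradiction\<close>

text \<open>
  The weak formulation is tested with \<open>decay k T t * annulus n (koranyi4 \<xi>) ^ (k + 3)\<close>. After
  absorbing the linear terms into the nonlinear one, the source term on the left is bounded by the
  initial datum, which contributes a quantity independent of \<open>T\<close>, and by the remainder of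
  \<open>nonlinear_term_absorbs_linear_terms\<close> integrated over \<open>[0, T]\<close> and a fixed compact set.
\<close>
lemma global_weak_solution_mass_bound:
  fixes f u0 :: "'n::finite heis \<Rightarrow> real" and u :: "real \<Rightarrow> 'n heis \<Rightarrow> real"
  fixes lam \<gamma> \<alpha> p n :: real
  assumes \<gamma>: "0 < \<gamma>" "\<gamma> < 1" and \<alpha>: "0 \<le> \<alpha>" and p: "1 < p"
    and n: "1 \<le> n" and k: "3 \<le> real k * (p - 1)"
    and u0: "integrable lebesgue (\<lambda>\<xi>. koranyi \<xi> powr (- mu TYPE('n) lam) * u0 \<xi>)"
    and f: "integrable lebesgue (\<lambda>\<xi>. koranyi \<xi> powr (- mu TYPE('n) lam) * f \<xi>)"
    and pos: "0 < (LINT \<xi>|lebesgue. koranyi \<xi> powr (- mu TYPE('n) lam) * f \<xi>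
                     * annulus n (koranyi4 \<xi>) ^ (k + 3))" (is "0 < ?F")
    and u: "global_weak_solution lam \<gamma> \<alpha> p f u0 u"
  obtains C where "\<And>T. 4 \<le> T \<Longrightarrow> T / 4 * (1 / 2) ^ (k + 3) * ?F
    \<le> (LINT \<xi>|lebesgue. \<bar>koranyi \<xi> powr (- mu TYPE('n) lam) * u0 \<xi>\<bar>)
        + C * T powr (- \<gamma> / (p - 1)) * T"
proof -
  define \<mu> where "\<mu> = mu TYPE('n) lam"
  define \<Phi> where "\<Phi> = (\<lambda>\<xi> :: 'n heis. annulus n (koranyi4 \<xi>) ^ (k + 3))"
  define K where "K = {\<xi> :: 'n heis. koranyi4 \<xi> \<le> n}"
  define v where "v = (\<lambda>t \<xi>. koranyi \<xi> powr \<mu> * u t \<xi>)"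
  let ?S = "{0<..} \<times> (UNIV :: 'n heis set)"
  have K: "compact K" unfolding K_def by (rule compact_koranyi4_le)
  have \<Phi>0: "0 \<le> \<Phi> \<xi>" and \<Phi>1: "\<Phi> \<xi> \<le> 1" for \<xi>
    using annulus_nonneg annulus_le_1[OF n] by (auto simp: \<Phi>_def intro: power_le_one)
  have \<Phi>K: "\<Phi> \<xi> = 0" if "\<xi> \<notin> K" for \<xi>
    using that annulus_pos_imp(2)[OF n, of "koranyi4 \<xi>"] annulus_nonneg[of n "koranyi4 \<xi>"]
    by (force simp: \<Phi>_def K_def)
  have \<Phi>m: "\<Phi> \<in> borel_measurable lebesgue"
    unfolding \<Phi>_def by (rule annulus_koranyi4_measurable[OF n])
  have cut: "integrable lebesgue (\<lambda>\<xi>. g \<xi> * \<Phi> \<xi>)" if "integrable lebesgue g" for g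
    using that \<Phi>0 \<Phi>1 \<Phi>m
    by (intro Bochner_Integration.integrable_bound[OF that] borel_measurable_times AE_I2)
       (auto simp: abs_mult intro!: mult_left_le)
  obtain C where C: "0 \<le> C"
    "\<And>T t V \<xi>. 1 \<le> T \<Longrightarrow> 0 \<le> t \<Longrightarrow> 0 \<le> V \<Longrightarrow>
      V * (koranyi \<xi> powr (- 2 * \<mu>) * (\<bar>decay_deriv k T t\<bar> * \<Phi> \<xi>) + \<bar>L_H lam (\<lambda>\<eta>. decay k T t * \<Phi> \<eta>) \<xi>\<bar>)
      \<le> koranyi \<xi> powr (- (p + 1) * \<mu>) * V powr p * (frac_int \<infinity> \<gamma> (decay k T) t * \<Phi> \<xi>)
        + C * T powr (- \<gamma> / (p - 1)) * (indicator {0..T} t * indicator K \<xi>)"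
    using nonlinear_term_absorbs_linear_terms[OF \<gamma> p n k, where lam=lam and ?'n='n] unfolding \<mu>_def \<Phi>_def K_def by metis
  show thesis
  proof (rule that)
    fix T :: real assume T: "4 \<le> T"
    define \<phi> where "\<phi> = (\<lambda>t \<xi>. decay k T t * \<Phi> \<xi>)"
    define lin where "lin = (\<lambda>(t, \<xi>). v t \<xi> *
       (koranyi \<xi> powr (- 2 * \<mu>) * deriv (\<lambda>s. \<phi> s \<xi>) t - L_H lam (\<phi> t) \<xi>))"
    define nonlin where "nonlin = (\<lambda>(t, \<xi>). koranyi \<xi> powr (- (p + 1) * \<mu>) * \<bar>v t \<xi>\<bar> powr p
       * frac_int \<infinity> \<gamma> (\<lambda>s. \<phi> s \<xi>) t)"
    define rest where "rest = (\<lambda>z. C * T powr (- \<gamma> / (p - 1)) *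
       (indicator {0..T} (fst z) * indicator K (snd z)))"
    have S: "{t. 0 < t \<and> ereal t < \<infinity>} \<times> (UNIV :: 'n heis set) = ?S" by auto
    have "test_function \<infinity> \<phi>"
      unfolding \<phi>_def
    proof (rule test_function_product)
      show "(decay k T has_real_derivative decay_deriv k T t) (at t)" for t
        using T by (intro DERIV_decay) simp
      show "continuous_on UNIV (decay_deriv k T)"
        unfolding decay_deriv_def using T by (intro continuous_intros) auto
      show "decay k T t = 0" if "T < t" for t using that T by (simp add: decay_def)
      show "C2_fun \<Phi>" unfolding \<Phi>_def by (rule C2_fun_annulus_koranyi4[OF n])
    qed (fact K \<Phi>K)+
    moreover have "0 \<le> \<phi> t \<xi>" for t \<xi> using \<Phi>0 by (simp add: \<phi>_def decay_def)
    ultimately have lin: "set_integrable lebesgue ?S lin"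
      and nonlin: "set_integrable lebesgue ?S nonlin"
      and eq: "- (LINT z:?S|lebesgue. lin z) = (LINT z:?S|lebesgue. nonlin z)
        + (LINT \<xi>|lebesgue. koranyi \<xi> powr (- 2 * \<mu>) * (koranyi \<xi> powr \<mu> * u0 \<xi>) * \<phi> 0 \<xi>)
        + (LINT z:?S|lebesgue. case z of (t, \<xi>) \<Rightarrow> koranyi \<xi> powr (- \<mu>) * t powr \<alpha> * f \<xi> * \<phi> t \<xi>)"
      using u unfolding global_weak_solution_def weak_solution_def Let_def S
        lin_def nonlin_def v_def \<mu>_def by blast+
    have init: "- (LINT \<xi>|lebesgue. \<bar>koranyi \<xi> powr (- \<mu>) * u0 \<xi>\<bar>)
      \<le> (LINT \<xi>|lebesgue. koranyi \<xi> powr (- 2 * \<mu>) * (koranyi \<xi> powr \<mu> * u0 \<xi>) * \<phi> 0 \<xi>)"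
    proof -
      have "koranyi \<xi> powr (- 2 * \<mu>) * (koranyi \<xi> powr \<mu> * u0 \<xi>) * \<phi> 0 \<xi>
          = (koranyi \<xi> powr (- \<mu>) * u0 \<xi>) * \<Phi> \<xi>" for \<xi>
        by (simp add: \<phi>_def decay_def mult.assoc[symmetric] powr_add[symmetric])
      moreover have "(LINT \<xi>|lebesgue. - \<bar>koranyi \<xi> powr (- \<mu>) * u0 \<xi>\<bar>)
          \<le> (LINT \<xi>|lebesgue. (koranyi \<xi> powr (- \<mu>) * u0 \<xi>) * \<Phi> \<xi>)"
      proof (rule integral_mono)
        show "integrable lebesgue (\<lambda>\<xi>. - \<bar>koranyi \<xi> powr (- \<mu>) * u0 \<xi>\<bar>)"
          using u0 unfolding \<mu>_def by (intro integrable_minus integrable_abs)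
        show "integrable lebesgue (\<lambda>\<xi>. (koranyi \<xi> powr (- \<mu>) * u0 \<xi>) * \<Phi> \<xi>)"
          using u0 unfolding \<mu>_def by (rule cut)
        fix \<xi>
        have "\<bar>(koranyi \<xi> powr (- \<mu>) * u0 \<xi>) * \<Phi> \<xi>\<bar> \<le> \<bar>koranyi \<xi> powr (- \<mu>) * u0 \<xi>\<bar>"
          using \<Phi>0[of \<xi>] \<Phi>1[of \<xi>] by (simp add: abs_mult mult_left_le)
        then show "- \<bar>koranyi \<xi> powr (- \<mu>) * u0 \<xi>\<bar> \<le> (koranyi \<xi> powr (- \<mu>) * u0 \<xi>) * \<Phi> \<xi>"
          by linarith
      qed
      ultimately show ?thesis by (simp only: Bochner_Integration.integral_minus)
    qed
    have source: "T / 4 * (1 / 2) ^ (k + 3) * ?F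
      \<le> (LINT z:?S|lebesgue. case z of (t, \<xi>) \<Rightarrow> koranyi \<xi> powr (- \<mu>) * t powr \<alpha> * f \<xi> * \<phi> t \<xi>)"
    proof -
      let ?a = "\<lambda>t. indicator {0<..} t * (t powr \<alpha> * decay k T t)"
      let ?b = "\<lambda>\<xi>. koranyi \<xi> powr (- \<mu>) * f \<xi> * \<Phi> \<xi>"
      have b: "integrable lebesgue ?b" using f unfolding \<mu>_def by (rule cut)
      have "(LINT z:?S|lebesgue. case z of (t, \<xi>) \<Rightarrow> koranyi \<xi> powr (- \<mu>) * t powr \<alpha> * f \<xi> * \<phi> t \<xi>)
        = (LINT z|lebesgue. ?a (fst z) * ?b (snd z))"
        unfolding set_lebesgue_integral_def
        by (intro Bochner_Integration.integral_cong refl) (auto simp: \<phi>_def indicator_def)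
      also have "\<dots> = (LINT t|lebesgue. ?a t) * (LINT \<xi>|lebesgue. ?b \<xi>)"
        by (rule lebesgue_integrable_times(2)[OF decay_time_integral(1)[OF T \<alpha>] b])
      finally show ?thesis
        using mult_right_mono[OF decay_time_integral(2)[OF T \<alpha>, of k] less_imp_le[OF pos]]
        by (simp add: \<Phi>_def \<mu>_def)
    qed
    have "integrable lebesgue (indicator {0..T} :: real \<Rightarrow> real)"
      using T by (intro integrable_real_indicator) auto
    moreover have "integrable lebesgue (indicator K :: 'n heis \<Rightarrow> real)"
      using lmeasurable_compact[OF K] by (intro integrable_real_indicator) (auto simp: fmeasurable_def)
    ultimately have "integrable lebesgue (\<lambda>z. indicator {0..T} (fst z) * indicator K (snd z) :: real)"
      and val: "(LINT z|lebesgue. indicator {0..T} (fst z) * indicator K (snd z) :: real)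
        = (LINT t|lebesgue. indicator {0..T} t) * (LINT \<xi>|lebesgue. indicator K \<xi>)"
      by (rule lebesgue_integrable_times)+
    then have rest: "integrable lebesgue rest"
      unfolding rest_def by (intro integrable_mult_right)
    have rest_val: "(LINT z|lebesgue. rest z) = C * measure lebesgue K * T powr (- \<gamma> / (p - 1)) * T"
      unfolding rest_def integral_mult_right_zero val using T by simp
    have rest0: "0 \<le> rest z" for z
      unfolding rest_def using C(1) by (intro mult_nonneg_nonneg) auto
    have absorb: "- lin z \<le> nonlin z + rest z" if "z \<in> ?S" for z
    proof -
      obtain t \<xi> where z: "z = (t, \<xi>)" by (cases z)
      with that have t: "0 < t" by simp
      have D: "deriv (\<lambda>s. \<phi> s \<xi>) t = decay_deriv k T t * \<Phi> \<xi>"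
        unfolding \<phi>_def using T by (intro DERIV_imp_deriv DERIV_cmult_right DERIV_decay) simp
      have "- lin z \<le> \<bar>v t \<xi>\<bar> * \<bar>koranyi \<xi> powr (- 2 * \<mu>) * (decay_deriv k T t * \<Phi> \<xi>) - L_H lam (\<phi> t) \<xi>\<bar>"
        by (simp add: lin_def z D abs_mult[symmetric])
      also have "\<dots> \<le> \<bar>v t \<xi>\<bar> * (koranyi \<xi> powr (- 2 * \<mu>) * (\<bar>decay_deriv k T t\<bar> * \<Phi> \<xi>)
          + \<bar>L_H lam (\<phi> t) \<xi>\<bar>)"
        using \<Phi>0[of \<xi>] by (intro mult_left_mono order.trans[OF abs_triangle_ineq4]) (auto simp: abs_mult)
      also have "\<dots> \<le> nonlin z + rest z"
        using C(2)[of T t "\<bar>v t \<xi>\<bar>" \<xi>] T t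
        by (simp add: nonlin_def rest_def z \<phi>_def frac_int_mult_const)
      finally show ?thesis .
    qed
    have "- (LINT z:?S|lebesgue. lin z) \<le> (LINT z:?S|lebesgue. nonlin z) + (LINT z|lebesgue. rest z)"
    proof -
      have "- (LINT z:?S|lebesgue. lin z) = (LINT z|lebesgue. - (indicator ?S z *\<^sub>R lin z))"
        unfolding set_lebesgue_integral_def by simp
      also have "\<dots> \<le> (LINT z|lebesgue. indicator ?S z *\<^sub>R nonlin z + rest z)"
      proof (rule integral_mono)
        show "integrable lebesgue (\<lambda>z. - (indicator ?S z *\<^sub>R lin z))"
          using lin unfolding set_integrable_def by (rule Bochner_Integration.integrable_minus)
        show "integrable lebesgue (\<lambda>z. indicator ?S z *\<^sub>R nonlin z + rest z)"
          using nonlin rest unfolding set_integrable_def by (rule Bochner_Integration.integrable_add)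
        show "- (indicator ?S z *\<^sub>R lin z) \<le> indicator ?S z *\<^sub>R nonlin z + rest z" for z
          using absorb[of z] rest0[of z] by (cases "z \<in> ?S") auto
      qed
      also have "\<dots> = (LINT z:?S|lebesgue. nonlin z) + (LINT z|lebesgue. rest z)"
        using nonlin rest unfolding set_integrable_def set_lebesgue_integral_def
        by (rule Bochner_Integration.integral_add)
      finally show ?thesis .
    qed
    then show "T / 4 * (1 / 2) ^ (k + 3) * ?F
      \<le> (LINT \<xi>|lebesgue. \<bar>koranyi \<xi> powr (- mu TYPE('n) lam) * u0 \<xi>\<bar>)
        + C * measure lebesgue K * T powr (- \<gamma> / (p - 1)) * T"
      using eq init source rest_val unfolding \<mu>_def by linarith
  qed
qed

theorem theorem1p3:
  fixes f u0 :: "'n::finite heis \<Rightarrow> real" and lam \<gamma> \<alpha> p :: real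
  assumes "0 < lam" and "lam < ((real (hom_dim TYPE('n)) - 2) / 2)\<^sup>2"
    and "0 < \<gamma>" and "\<gamma> < 1" and "0 \<le> \<alpha>"
    and "integrable lebesgue (\<lambda>\<xi>. koranyi \<xi> powr (- mu TYPE('n) lam) * u0 \<xi>)"
    and "integrable lebesgue (\<lambda>\<xi>. koranyi \<xi> powr (- mu TYPE('n) lam) * f \<xi>)"
    and "0 < (LINT \<xi>|lebesgue. koranyi \<xi> powr (- mu TYPE('n) lam) * f \<xi>)"
    and "1 < p"
  shows "\<not> (\<exists>u. global_weak_solution lam \<gamma> \<alpha> p f u0 u)"
proof
  assume "\<exists>u. global_weak_solution lam \<gamma> \<alpha> p f u0 u"
  then obtain u where u: "global_weak_solution lam \<gamma> \<alpha> p f u0 u" by blast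
  \<comment> \<open>The exponent grows as \<open>p\<close> approaches \<open>1\<close>: the two powers lost by differentiation must stay below
    the fraction \<open>1 - 1 / p\<close> of the exponent that Young's inequality leaves free.\<close>
  obtain k :: nat where "3 / (p - 1) \<le> real k" using real_arch_simple by blast
  then have k: "3 \<le> real k * (p - 1)" using \<open>1 < p\<close> by (simp add: pos_divide_le_eq)
  \<comment> \<open>The spatial cut-off is fixed from here on; only \<open>T\<close> varies.\<close>
  obtain n where n: "1 \<le> n" and F: "0 < (LINT \<xi>|lebesgue. koranyi \<xi> powr (- mu TYPE('n) lam) * f \<xi>
      * annulus n (koranyi4 \<xi>) ^ (k + 3))"
    using annulus_captures_mass[OF assms(7,8)] by blast
  define c where "c = 1 / 4 * (1 / 2) ^ (k + 3) * (LINT \<xi>|lebesgue. koranyi \<xi> powr (- mu TYPE('n) lam) * f \<xi>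
      * annulus n (koranyi4 \<xi>) ^ (k + 3))"
  define U where "U = (LINT \<xi>|lebesgue. \<bar>koranyi \<xi> powr (- mu TYPE('n) lam) * u0 \<xi>\<bar>)"
  have c: "0 < c" using F by (simp add: c_def)
  obtain C where mass: "\<And>T. 4 \<le> T \<Longrightarrow> T / 4 * (1 / 2) ^ (k + 3)
      * (LINT \<xi>|lebesgue. koranyi \<xi> powr (- mu TYPE('n) lam) * f \<xi> * annulus n (koranyi4 \<xi>) ^ (k + 3))
    \<le> U + C * T powr (- \<gamma> / (p - 1)) * T"
    using global_weak_solution_mass_bound[OF assms(3-5,9) n k assms(6,7) F u] unfolding U_def by blast
  have C: "c * T \<le> U + C * T powr (- \<gamma> / (p - 1)) * T" if "4 \<le> T" for T
    using mass[OF that] by (simp add: c_def mult_ac)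
  have "((\<lambda>T. U / T + C * T powr (- \<gamma> / (p - 1))) \<longlongrightarrow> 0 + C * 0) at_top"
  proof (intro tendsto_add tendsto_mult tendsto_const)
    show "((\<lambda>T. U / T) \<longlongrightarrow> 0) at_top"
      by (intro tendsto_divide_0[OF tendsto_const] filterlim_at_top_imp_at_infinity filterlim_ident)
    show "((\<lambda>T. T powr (- \<gamma> / (p - 1))) \<longlongrightarrow> 0) at_top"
      using \<open>0 < \<gamma>\<close> \<open>1 < p\<close> by (intro tendsto_neg_powr filterlim_ident) (simp add: divide_neg_pos)
  qed
  then have "\<forall>\<^sub>F T in at_top. U / T + C * T powr (- \<gamma> / (p - 1)) < c"
    using c by (intro order_tendstoD(2)) auto
  then have "\<forall>\<^sub>F T :: real in at_top. False"
    using eventually_ge_at_top[of 4]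
  proof eventually_elim
    case (elim T)
    then have "(U / T + C * T powr (- \<gamma> / (p - 1))) * T < c * T"
      by (intro mult_strict_right_mono) auto
    with C[of T] elim show False by (simp add: distrib_right)
  qed
  then show False by simp
qed

end
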